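(* Let $G=\mathbb{Z}$ or $G=\mathbb{Z}/m\mathbb{Z}$ for some integer $m\ge2$, let $N\ge1$, let $1<p<\infty$ and $q=\tfrac{p}{p-1}$. Let $f,g:G^N\to\mathbb{R}$ be real valued test functions, with heat extensions $\tilde f(\cdot,t)=e^{t\Delta}f$ and $\tilde g(\cdot,t)=e^{t\Delta}g$. Then, for each choice of sign $\pm$, $$2\sum_{i=1}^N\int_0^\infty\sum_{n\in G^N}\big[\partial_+^i\tilde f(n,t)\,\partial_+^i\tilde g(n,t)\big]_{\pm}\,dt\le\mathfrak{C}_p\,\|f\|_p\,\|g\|_q ,$$ where $[x]_+=\max\{x,0\}$ and $[x]_-=\max\{-x,0\}$ denote positive and negative parts and $\mathfrak{C}_p$ is the Choi constant.
   Context: Test functions are finitely supported functions on $G^N$, and $\|\cdot\|_p$ is the $L^p$ norm with respect to counting measure on $G^N$. With $e_i\in G^N$ the element having the generator $1$ of $G$ in the $i$-th coordinate and $0$ elsewhere, $\partial_+^if(n)=f(n+e_i)-f(n)$, $\partial_-^if(n)=f(n)-f(n-e_i)$, acting in the variable $n$, and $\Delta=\sum_{i=1}^N\partial_+^i\partial_-^i$. The heat extension $\tilde f(n,t)=(e^{t\Delta}f)(n)$, $t\ge0$, solves $\partial_t\tilde f-\Delta\tilde f=0$ with $\tilde f(\cdot,0)=f$. Choi constant: $\mathfrak{C}_p$ is the smallest constant $C$ such that $\big\|\sum_{k=1}^n\theta_kd_k\big\|_p\le C\big\|\sum_{k=1}^nd_k\big\|_p$ for every $n\ge1$, every probability space with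 filtration $(\mathcal{F}_k)_{k\ge0}$, every real valued martingale difference sequence $(d_k)_{k\ge1}$ in $L^p$ adapted to it, and every predictable sequence $(\theta_k)_{k\ge1}$ ($\theta_k$ is $\mathcal{F}_{k-1}$-measurable) taking values in $\{0,1\}$. *)

theory Defs
  imports "HOL-Probability.Probability" "HOL-Algebra.Product_Groups"
begin

definition Lp_norm :: "'a measure \<Rightarrow> real \<Rightarrow> ('a \<Rightarrow> real) \<Rightarrow> real" where
  "Lp_norm M p f = (\<integral>x. \<bar>f x\<bar> powr p \<partial>M) powr (1 / p)"

section \<open>Discrete calculus on powers of a cyclic group\<close>

text \<open>
  Below, \<open>G\<close> is \<^const>\<open>integer_group\<close> or \<^const>\<open>integer_mod_group\<close>; the operation written
  \<open>\<otimes>\<close> is addition (modulo \<open>m\<close>). Functions on \<open>G\<^sup>N\<close> matter only through their values on the carrier.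
\<close>

abbreviation power_group :: "int monoid \<Rightarrow> nat \<Rightarrow> (nat \<Rightarrow> int) monoid" where
  "power_group G N \<equiv> product_group {1..N} (\<lambda>_. G)"

definition unit_elem :: "nat \<Rightarrow> nat \<Rightarrow> (nat \<Rightarrow> int)" where
  "unit_elem N i = (\<lambda>j\<in>{1..N}. if j = i then 1 else 0)"

definition test_function :: "int monoid \<Rightarrow> nat \<Rightarrow> ((nat \<Rightarrow> int) \<Rightarrow> real) \<Rightarrow> bool" where
  "test_function G N f \<longleftrightarrow> finite {n \<in> carrier (power_group G N). f n \<noteq> 0}"

definition diff_plus ::
  "int monoid \<Rightarrow> nat \<Rightarrow> nat \<Rightarrow> ((nat \<Rightarrow> int) \<Rightarrow> real) \<Rightarrow> (nat \<Rightarrow> int) \<Rightarrow> real" where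
  "diff_plus G N i f n = f (n \<otimes>\<^bsub>power_group G N\<^esub> unit_elem N i) - f n"

definition diff_minus ::
  "int monoid \<Rightarrow> nat \<Rightarrow> nat \<Rightarrow> ((nat \<Rightarrow> int) \<Rightarrow> real) \<Rightarrow> (nat \<Rightarrow> int) \<Rightarrow> real" where
  "diff_minus G N i f n =
     f n - f (n \<otimes>\<^bsub>power_group G N\<^esub> inv\<^bsub>power_group G N\<^esub> unit_elem N i)"

definition laplacian ::
  "int monoid \<Rightarrow> nat \<Rightarrow> ((nat \<Rightarrow> int) \<Rightarrow> real) \<Rightarrow> (nat \<Rightarrow> int) \<Rightarrow> real" where
  "laplacian G N f n = (\<Sum>i=1..N. diff_plus G N i (diff_minus G N i f) n)"

text \<open>
  The semigroup \<open>e\<^bsup>t\<Delta>\<^esup>\<close> as exponential series, evaluated pointwise: \<open>\<Delta>\<close> is a bounded operator for the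
  supremum norm, so the series converges absolutely for every test function.
\<close>

definition heat_ext ::
  "int monoid \<Rightarrow> nat \<Rightarrow> ((nat \<Rightarrow> int) \<Rightarrow> real) \<Rightarrow> (nat \<Rightarrow> int) \<Rightarrow> real \<Rightarrow> real" where
  "heat_ext G N f n t = (\<Sum>k. t ^ k / fact k * (laplacian G N ^^ k) f n)"

section \<open>The Choi constant\<close>

definition Lp_martingale_difference ::
  "'a measure \<Rightarrow> (nat \<Rightarrow> 'a measure) \<Rightarrow> real \<Rightarrow> (nat \<Rightarrow> 'a \<Rightarrow> real) \<Rightarrow> bool" where
  "Lp_martingale_difference M F p d \<longleftrightarrow>
     (\<forall>k\<ge>1. d k \<in> borel_measurable (F k) \<and>
            integrable M (\<lambda>x. \<bar>d k x\<bar> powr p) \<and>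
            (AE x in M. real_cond_exp M (F (k - 1)) (d k) x = 0))"

definition predictable_01 ::
  "'a measure \<Rightarrow> (nat \<Rightarrow> 'a measure) \<Rightarrow> (nat \<Rightarrow> 'a \<Rightarrow> real) \<Rightarrow> bool" where
  "predictable_01 M F \<theta> \<longleftrightarrow>
     (\<forall>k\<ge>1. \<theta> k \<in> borel_measurable (F (k - 1)) \<and> (\<forall>x\<in>space M. \<theta> k x \<in> {0, 1}))"

definition choi_bound :: "'a itself \<Rightarrow> real \<Rightarrow> real \<Rightarrow> bool" where
  "choi_bound T p C \<longleftrightarrow>
     (\<forall>(M :: 'a measure) F d \<theta> n.
        prob_space M \<and> filtration (space M) F \<and> (\<forall>k. subalgebra M (F k)) \<and>
        Lp_martingale_difference M F p d \<and> predictable_01 M F \<theta> \<and> n \<ge> 1 \<longrightarrow>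
        Lp_norm M p (\<lambda>x. \<Sum>k=1..n. \<theta> k x * d k x) \<le> C * Lp_norm M p (\<lambda>x. \<Sum>k=1..n. d k x))"

text \<open>
  A HOL formula cannot quantify over the type carrying the probability space, so the constant is
  defined with the sample type \<^typ>\<open>nat \<Rightarrow> real\<close>; the lemma \<open>choi_bound_transfer\<close> below shows that
  this already gives the bound on probability spaces of every type. The infimum is taken in
  \<^typ>\<open>ennreal\<close>, so that it is \<open>\<infinity>\<close> (and not unspecified) should no \<open>C\<close> be admissible.
\<close>

definition choi_constant :: "real \<Rightarrow> ennreal" where
  "choi_constant p = (INF C \<in> {C. choi_bound TYPE(nat \<Rightarrow> real) p C}. ennreal C)"

lemma choi_bound_transfer:
  assumes p: "1 < p" and C: "choi_bound TYPE(nat \<Rightarrow> real) p C"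
  shows "choi_bound TYPE('a) p C"
  unfolding choi_bound_def
proof (intro allI impI, elim conjE)
  fix M :: "'a measure" and F d \<theta> and n :: nat
  assume M: "prob_space M" and filt: "filtration (space M) F"
    and sub: "\<forall>k. subalgebra M (F k)" and md: "Lp_martingale_difference M F p d"
    and pr: "predictable_01 M F \<theta>" and n: "1 \<le> n"
  interpret M: prob_space M by (rule M)
  interpret filtration "space M" F by (rule filt)
  have spF: "space (F k) = space M" for k
    by (rule space_F)
  have F_mono: "f \<in> borel_measurable (F j) \<Longrightarrow> j \<le> k \<Longrightarrow> f \<in> borel_measurable (F k)"
    for f :: "'a \<Rightarrow> real" and j k
    using sets_F_mono[of j k] spF by (auto simp: measurable_def)
  have F_M: "f \<in> borel_measurable (F j) \<Longrightarrow> f \<in> borel_measurable M" for f :: "'a \<Rightarrow> real" and j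
    using sub measurable_from_subalg by blast
  have d_meas: "d k \<in> borel_measurable (F k)"
    and d_Lp: "integrable M (\<lambda>x. \<bar>d k x\<bar> powr p)"
    and d_ce: "AE x in M. real_cond_exp M (F (k - 1)) (d k) x = 0" if "k \<ge> 1" for k
    using md that by (auto simp: Lp_martingale_difference_def)
  have th_meas: "\<theta> k \<in> borel_measurable (F (k - 1))"
    and th01: "x \<in> space M \<Longrightarrow> \<theta> k x = 0 \<or> \<theta> k x = 1" if "k \<ge> 1" for k x
    using pr that by (auto simp: predictable_01_def)
  have d_int: "integrable M (d k)" if "k \<ge> 1" for k
  proof (rule Bochner_Integration.integrable_bound)
    show "integrable M (\<lambda>x. 1 + \<bar>d k x\<bar> powr p)"
      using d_Lp[OF that] by simp
    show "d k \<in> borel_measurable M"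
      using d_meas[OF that] by (rule F_M)
    have "y \<le> 1 + y powr p" if "y \<ge> 0" for y :: real
    proof (cases "y \<le> 1")
      case False
      then have "y powr 1 \<le> y powr p" using p by (intro powr_mono) auto
      then show ?thesis using False by simp
    qed (use add_mono[of y 1 0 "y powr p"] in simp)
    then show "AE x in M. norm (d k x) \<le> norm (1 + \<bar>d k x\<bar> powr p)"
      by (intro AE_I2) (simp add: abs_of_nonneg[OF add_nonneg_nonneg])
  qed

  define Z :: "'a \<Rightarrow> nat \<Rightarrow> real" where
    "Z x i = (if i = 0 then 0 else if even i then d (i div 2) x else \<theta> (Suc (i div 2)) x)" for x i
  have Z_comp: "(\<lambda>x. Z x i) \<in> borel_measurable (F (i div 2))" for i
  proof -
    consider "i = 0" | "i \<noteq> 0" "even i" | "odd i" by (cases "i = 0") auto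
    then show ?thesis
    proof cases
      case 1 then show ?thesis by (simp add: Z_def)
    next
      case 2
      then have "i div 2 \<ge> 1" by auto
      then show ?thesis using 2 d_meas[of "i div 2"] by (simp add: Z_def)
    next
      case 3
      then have "(\<lambda>x. Z x i) = \<theta> (Suc (i div 2))" by (auto simp: Z_def)
      then show ?thesis using th_meas[of "Suc (i div 2)"] by simp
    qed
  qed
  define P :: "(nat \<Rightarrow> real) measure" where "P = PiM UNIV (\<lambda>_. borel)"
  have space_P: "space P = UNIV" by (simp add: P_def space_PiM)
  have comp_P: "(\<lambda>z. z i) \<in> borel_measurable P" for i
    unfolding P_def by simp
  have Z_meas: "Z \<in> M \<rightarrow>\<^sub>M P"
    unfolding P_def using measurable_PiM_single'[of UNIV "\<lambda>i x. Z x i" M "\<lambda>_. borel"]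
      F_M[OF Z_comp] by simp
  define M' where "M' = distr M P Z"
  have space_M': "space M' = UNIV" and sets_M': "sets M' = sets P"
    by (simp_all add: M'_def space_P)
  interpret M': prob_space M'
    unfolding M'_def by (rule M.prob_space_distr[OF Z_meas])

  define gen :: "nat \<Rightarrow> (nat \<Rightarrow> real) set set" where
    "gen k = {(\<lambda>z. z i) -` A | i A. i div 2 \<le> k \<and> A \<in> sets borel}" for k
  define F' where "F' k = sigma UNIV (gen k)" for k
  have space_F': "space (F' k) = UNIV" and sets_F': "sets (F' k) = sigma_sets UNIV (gen k)" for k
    by (simp_all add: F'_def)
  have gen_P: "gen k \<subseteq> sets P" for k
    using measurable_sets[OF comp_P] by (auto simp: gen_def space_P)
  have F'_P: "sets (F' k) \<subseteq> sets P" for k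
    unfolding sets_F' using sets.sigma_sets_subset[OF gen_P, of k] by (simp add: space_P)
  have gen_mono: "gen j \<subseteq> gen k" if "j \<le> k" for j k
    using that unfolding gen_def by fastforce
  have filt': "filtration (space M') F'"
    by unfold_locales
       (simp_all add: space_M' space_F' sets_F' sigma_sets_mono' gen_mono)
  have sub': "subalgebra M' (F' k)" for k
    using F'_P by (simp add: subalgebra_def space_M' space_F' sets_M')
  have comp_F': "(\<lambda>z. z i) \<in> borel_measurable (F' k)" if "i div 2 \<le> k" for i k
  proof (rule measurableI)
    fix A :: "real set" assume "A \<in> sets borel"
    then have "(\<lambda>z. z i) -` A \<in> gen k" using that by (auto simp: gen_def)
    then show "(\<lambda>z. z i) -` A \<inter> space (F' k) \<in> sets (F' k)"
      by (auto simp: space_F' sets_F')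
  qed auto
  have Z_F: "Z \<in> F k \<rightarrow>\<^sub>M F' k" for k
    unfolding F'_def
  proof (rule measurable_measure_of)
    fix B assume "B \<in> gen k"
    then obtain i A where B: "B = (\<lambda>z. z i) -` A" and i: "i div 2 \<le> k" and A: "A \<in> sets borel"
      by (auto simp: gen_def)
    have "(\<lambda>x. Z x i) -` A \<inter> space (F k) \<in> sets (F k)"
      using F_mono[OF Z_comp i] A by (rule measurable_sets)
    then show "Z -` B \<inter> space (F k) \<in> sets (F k)"
      by (simp add: B vimage_def)
  qed auto

  define d' :: "nat \<Rightarrow> (nat \<Rightarrow> real) \<Rightarrow> real" where "d' k z = z (2 * k)" for k z
  define \<theta>' :: "nat \<Rightarrow> (nat \<Rightarrow> real) \<Rightarrow> real" where
    "\<theta>' k z = (if z (2 * k - 1) = 1 then 1 else 0)" for k z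
  have d'_Z: "d' k (Z x) = d k x" if "k \<ge> 1" for k x
    using that by (simp add: d'_def Z_def)
  have th'_Z: "\<theta>' k (Z x) = \<theta> k x" if "k \<ge> 1" "x \<in> space M" for k x
  proof -
    from that(1) obtain j where j: "k = Suc j" by (cases k) auto
    have "Z x (2 * k - 1) = \<theta> k x" by (simp add: Z_def j)
    then show ?thesis using th01[OF that] by (auto simp: \<theta>'_def)
  qed
  have d'_P: "d' k \<in> borel_measurable P" for k
    unfolding d'_def by (rule comp_P)
  have "predictable_01 M' F' \<theta>'"
    unfolding predictable_01_def
  proof (intro allI impI conjI ballI)
    fix k :: nat assume "1 \<le> k"
    then have [measurable]: "(\<lambda>z. z (2 * k - 1)) \<in> borel_measurable (F' (k - 1))"
      by (intro comp_F') auto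
    show "\<theta>' k \<in> borel_measurable (F' (k - 1))"
      unfolding \<theta>'_def by measurable
  qed (auto simp: \<theta>'_def)
  moreover have "Lp_martingale_difference M' F' p d'"
    unfolding Lp_martingale_difference_def
  proof (intro allI impI conjI)
    fix k :: nat assume k: "1 \<le> k"
    show "d' k \<in> borel_measurable (F' k)"
      unfolding d'_def by (rule comp_F') simp
    show "integrable M' (\<lambda>x. \<bar>d' k x\<bar> powr p)"
      unfolding M'_def using d'_P d_Lp[OF k] d'_Z[OF k]
      by (subst integrable_distr_eq[OF Z_meas]) auto
    have int': "integrable M' (d' k)"
      unfolding M'_def using d'_P d_int[OF k] d'_Z[OF k]
      by (subst integrable_distr_eq[OF Z_meas]) auto
    interpret S: finite_measure_subalgebra M "F (k - 1)"
      by unfold_locales (use sub in auto)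
    interpret S': finite_measure_subalgebra M' "F' (k - 1)"
      by unfold_locales (use sub' in auto)
    show "AE x in M'. real_cond_exp M' (F' (k - 1)) (d' k) x = 0"
    proof (rule S'.real_cond_exp_charact)
      fix A assume A: "A \<in> sets (F' (k - 1))"
      then have AP: "A \<in> sets P" using F'_P by auto
      define B where "B = Z -` A \<inter> space M"
      have B: "B \<in> sets (F (k - 1))"
        using measurable_sets[OF Z_F A] by (simp add: B_def spF)
      have [measurable]: "B \<in> sets M" using B sub by (auto simp: subalgebra_def)
      have "(\<integral>x\<in>A. d' k x \<partial>M') = (\<integral>x. indicator A (Z x) *\<^sub>R d' k (Z x) \<partial>M)"
        unfolding set_lebesgue_integral_def M'_def
        by (rule integral_distr[OF Z_meas]) (use AP d'_P in measurable)
      also have "\<dots> = (\<integral>x\<in>B. d k x \<partial>M)"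
        unfolding set_lebesgue_integral_def
        by (rule Bochner_Integration.integral_cong)
           (auto simp: B_def d'_Z[OF k] indicator_def)
      also have "\<dots> = (\<integral>x\<in>B. real_cond_exp M (F (k - 1)) (d k) x \<partial>M)"
        by (rule S.real_cond_exp_intA[OF d_int[OF k] B])
      also have "\<dots> = (\<integral>x. 0 \<partial>M)"
        unfolding set_lebesgue_integral_def
        by (rule integral_cong_AE) (use d_ce[OF k] in \<open>auto intro: borel_measurable_cond_exp2\<close>)
      finally show "(\<integral>x\<in>A. d' k x \<partial>M') = (\<integral>x\<in>A. 0 \<partial>M')"
        by (simp add: set_lebesgue_integral_def)
    qed (use int' in auto)
  qed
  ultimately have "Lp_norm M' p (\<lambda>z. \<Sum>k=1..n. \<theta>' k z * d' k z)
      \<le> C * Lp_norm M' p (\<lambda>z. \<Sum>k=1..n. d' k z)"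
    using C filt' sub' n M'.prob_space_axioms unfolding choi_bound_def by blast
  moreover have "Lp_norm M' p (\<lambda>z. \<Sum>k=1..n. \<theta>' k z * d' k z)
      = Lp_norm M p (\<lambda>x. \<Sum>k=1..n. \<theta> k x * d k x)"
  proof -
    have [measurable]: "\<theta>' k \<in> borel_measurable P" "d' k \<in> borel_measurable P" for k
      using comp_P[of "2 * k - 1"] d'_P unfolding \<theta>'_def by measurable
    have "(\<integral>z. \<bar>\<Sum>k=1..n. \<theta>' k z * d' k z\<bar> powr p \<partial>M')
        = (\<integral>x. \<bar>\<Sum>k=1..n. \<theta>' k (Z x) * d' k (Z x)\<bar> powr p \<partial>M)"
      unfolding M'_def by (rule integral_distr[OF Z_meas]) measurable
    also have "\<dots> = (\<integral>x. \<bar>\<Sum>k=1..n. \<theta> k x * d k x\<bar> powr p \<partial>M)"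
      by (rule Bochner_Integration.integral_cong) (auto simp: th'_Z d'_Z)
    finally show ?thesis by (simp add: Lp_norm_def)
  qed
  moreover have "Lp_norm M' p (\<lambda>z. \<Sum>k=1..n. d' k z) = Lp_norm M p (\<lambda>x. \<Sum>k=1..n. d k x)"
  proof -
    note d'_P [measurable]
    have "(\<integral>z. \<bar>\<Sum>k=1..n. d' k z\<bar> powr p \<partial>M') = (\<integral>x. \<bar>\<Sum>k=1..n. d' k (Z x)\<bar> powr p \<partial>M)"
      unfolding M'_def by (rule integral_distr[OF Z_meas]) measurable
    then show ?thesis by (simp add: Lp_norm_def d'_Z)
  qed
  ultimately show "Lp_norm M p (\<lambda>x. \<Sum>k=1..n. \<theta> k x * d k x)
      \<le> C * Lp_norm M p (\<lambda>x. \<Sum>k=1..n. d k x)"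
    by simp
qed

end

(*
  The heat flow is the limit of a discrete martingale. Split time into small steps of length h, and in
  each step toss one coin per direction +-e_i, in turn: with probability h the walk jumps in that
  direction. Because only one jump is possible at a toss, whether the product of the two increments is
  positive on the edge in question is known before the toss, so restricting to the edges where the
  product has the chosen sign is a martingale transform by predictable {0,1}-valued multipliers. Pairing
  the transform of the martingale of f with that of g gives (up to a factor 1 - h) a Riemann sum of the
  integral, and Hoelder's inequality together with the Choi constant bounds it; the walk is started from
  the uniform law on a finite set, which is large enough to see any prescribed finite set of edges.
  Each edge is crossed in two directions, which produces the factor 2.
*)
theory Submission
  imports Defs
begin

section \<open>Finitely supported probability mass functions\<close>

text \<open>Time is reversed: at walk time \<open>k\<close> the process reads the Euler scheme after
  \<open>J - k\<close> steps, so its terminal value is the datum itself, and the bound involves the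
  norms of \<open>f\<close> and \<open>g\<close> rather than those of approximate heat extensions.
  An infinite group has no uniform law, and the size of the finite set \<open>A\<close> of starting
  points is not controlled; but the lower bound for the pairing and the upper bound both carry the
  factor \<open>1 / card A\<close>, because \<open>1 / p + 1 / q = 1\<close>, and it cancels. The
  approximation constants grow exponentially in the time horizon \<open>T\<close>. This is harmless:
  \<open>T\<close> and the finite set of edges stay fixed while \<open>h\<close> tends to 0, and
  only afterwards does monotone convergence exhaust time and space. All laws have finite support, so
  integrability is automatic and conditioning is done coin by coin. Since the Choi constant is an
  infimum in \<open>ennreal\<close> and may be infinite, the case of a vanishing norm needs its own
  argument.\<close>

lemma expectation_pair_pmf_finite:
  fixes f :: "'a \<times> 'b \<Rightarrow> real"
  assumes "finite (set_pmf P)" "finite (set_pmf Q)"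
  shows "measure_pmf.expectation (pair_pmf P Q) f
    = measure_pmf.expectation P (\<lambda>x. measure_pmf.expectation Q (\<lambda>y. f (x, y)))"
proof -
  have "measure_pmf.expectation (pair_pmf P Q) f
      = (\<Sum>z\<in>set_pmf P \<times> set_pmf Q. f z * pmf (pair_pmf P Q) z)"
    using assms by (intro integral_measure_pmf_real) auto
  also have "\<dots> = (\<Sum>x\<in>set_pmf P. \<Sum>y\<in>set_pmf Q. f (x, y) * (pmf P x * pmf Q y))"
    by (simp add: sum.cartesian_product' pmf_pair)
  also have "\<dots> = (\<Sum>x\<in>set_pmf P. measure_pmf.expectation Q (\<lambda>y. f (x, y)) * pmf P x)"
    using assms by (intro sum.cong refl)
      (simp add: integral_measure_pmf_real[OF assms(2)] sum_distrib_left mult_ac)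
  also have "\<dots> = measure_pmf.expectation P (\<lambda>x. measure_pmf.expectation Q (\<lambda>y. f (x, y)))"
    using assms by (intro integral_measure_pmf_real[symmetric]) auto
  finally show ?thesis .
qed

text \<open>Young's inequality for the normalised functions, integrated: the weights
  \<open>1 / p\<close> and \<open>1 / q\<close> add up to 1.\<close>

lemma Holder_inequality_pmf:
  fixes Y Z :: "'a \<Rightarrow> real"
  assumes fin: "finite (set_pmf P)" and p: "1 < p" and q: "q = p / (p - 1)"
  shows "measure_pmf.expectation P (\<lambda>x. Y x * Z x)
    \<le> Lp_norm (measure_pmf P) p Y * Lp_norm (measure_pmf P) q Z"
proof -
  let ?E = "measure_pmf.expectation P"
  have int: "integrable (measure_pmf P) (g :: 'a \<Rightarrow> real)" for g
    using fin by (rule integrable_measure_pmf_finite)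
  have q1: "1 < q" and pq: "1 / p + 1 / q = 1"
    using p by (auto simp: q field_simps)
  \<comment> \<open>The normalisation divides by both norms, so a vanishing norm is settled first:
    that function is zero almost everywhere.\<close>
  have zero: "?E (\<lambda>x. Y x * Z x) = 0"
    if "Lp_norm (measure_pmf P) r g = 0" "g = Y \<or> g = Z" for g r
  proof -
    have "?E (\<lambda>x. \<bar>g x\<bar> powr r) = 0"
      using that(1) by (simp add: Lp_norm_def)
    then have "AE x in measure_pmf P. \<bar>g x\<bar> powr r = 0"
      using int by (subst (asm) integral_nonneg_eq_0_iff_AE) auto
    then have "AE x in measure_pmf P. Y x * Z x = 0"
      using that(2) by (auto elim!: eventually_mono)
    then show ?thesis
      by (rule integral_eq_zero_AE)
  qed
  define a where "a = Lp_norm (measure_pmf P) p Y"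
  define b where "b = Lp_norm (measure_pmf P) q Z"
  have nonneg: "a \<ge> 0" "b \<ge> 0"
    by (simp_all add: a_def b_def Lp_norm_def)
  show ?thesis
  proof (cases "a = 0 \<or> b = 0")
    case True
    then have "?E (\<lambda>x. Y x * Z x) = 0"
      using zero[of p Y] zero[of q Z] by (auto simp: a_def b_def)
    then show ?thesis
      using nonneg by (simp add: a_def[symmetric] b_def[symmetric])
  next
    case False
    with nonneg have pos: "a > 0" "b > 0" by auto
    have ap: "?E (\<lambda>x. \<bar>Y x\<bar> powr p) = a powr p" "?E (\<lambda>x. \<bar>Z x\<bar> powr q) = b powr q"
      using p q1 by (auto simp: a_def b_def Lp_norm_def powr_powr)
    have "?E (\<lambda>x. Y x * Z x) / (a * b) = ?E (\<lambda>x. Y x / a * (Z x / b))"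
      by simp
    also have "\<dots> \<le> ?E (\<lambda>x. \<bar>Y x\<bar> powr p / (a powr p * p) + \<bar>Z x\<bar> powr q / (b powr q * q))"
    proof (rule integral_mono[OF int int])
      fix x
      have "Y x / a * (Z x / b) \<le> (\<bar>Y x\<bar> / a) * (\<bar>Z x\<bar> / b)"
        using abs_ge_self[of "Y x / a * (Z x / b)"] pos by (simp add: abs_mult)
      also have "\<dots> \<le> (\<bar>Y x\<bar> / a) powr p / p + (\<bar>Z x\<bar> / b) powr q / q"
        using pos p q1 pq by (intro Youngs_inequality) auto
      finally show "Y x / a * (Z x / b)
          \<le> \<bar>Y x\<bar> powr p / (a powr p * p) + \<bar>Z x\<bar> powr q / (b powr q * q)"
        using pos by (simp add: powr_divide)
    qed
    also have "\<dots> = ?E (\<lambda>x. \<bar>Y x\<bar> powr p) / (a powr p * p) + ?E (\<lambda>x. \<bar>Z x\<bar> powr q) / (b powr q * q)"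
      using int by (subst Bochner_Integration.integral_add) auto
    also have "\<dots> = 1"
      using pos pq by (simp add: ap)
    finally show ?thesis
      using pos by (simp add: a_def b_def divide_le_eq)
  qed
qed

text \<open>Index 1 of the martingale difference sequence will hold the initial value and index
  \<open>k + 2\<close> the coin \<open>k\<close>; this separates the two.\<close>

lemma sum_from_one:
  fixes f :: "nat \<Rightarrow> real"
  shows "(\<Sum>k=1..n + 1. f k) = f 1 + (\<Sum>k<n. f (k + 2))"
  by (induction n) simp_all

section \<open>A lazy walk driven by independent coins\<close>

text \<open>\<open>S k\<close> is the only jump on offer at time \<open>k\<close>. Bijectivity makes
  the walk with fixed coins a bijection of \<open>V\<close>, so counting measure is preserved for
  each coin outcome.\<close>

locale lazy_walk =
  fixes V :: "'v set" and S :: "nat \<Rightarrow> 'v \<Rightarrow> 'v" and h :: real and J :: nat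
  assumes bij: "\<And>k. bij_betw (S k) V V" and h: "0 < h" "h < 1"
begin

primrec walk :: "nat \<Rightarrow> 'v \<Rightarrow> (nat \<Rightarrow> bool) \<Rightarrow> 'v" where
  "walk 0 x \<xi> = x"
| "walk (Suc k) x \<xi> = (if \<xi> k then S k (walk k x \<xi>) else walk k x \<xi>)"

text \<open>Coins from \<open>J\<close> on are frozen at the default \<open>False\<close>, which
  keeps the support finite.\<close>

definition coins :: "(nat \<Rightarrow> bool) pmf" where
  "coins = Pi_pmf {..<J} False (\<lambda>_. bernoulli_pmf h)"

abbreviation E :: "((nat \<Rightarrow> bool) \<Rightarrow> real) \<Rightarrow> real" where
  "E \<equiv> measure_pmf.expectation coins"

text \<open>Measurability with respect to the first \<open>k\<close> coins, encoded as functional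
  dependence: overwriting a later coin has no effect.\<close>

definition depends_below :: "nat \<Rightarrow> ((nat \<Rightarrow> bool) \<Rightarrow> 'b) \<Rightarrow> bool" where
  "depends_below k \<Psi> \<longleftrightarrow> (\<forall>\<xi> \<xi>'. (\<forall>i<k. \<xi> i = \<xi>' i) \<longrightarrow> \<Psi> \<xi> = \<Psi> \<xi>')"

text \<open>Jump of the value of the process \<open>w k (walk k x \<xi>)\<close> when the \<open>k\<close>-th coin shows heads.\<close>
definition jump :: "(nat \<Rightarrow> 'v \<Rightarrow> real) \<Rightarrow> nat \<Rightarrow> 'v \<Rightarrow> real" where
  "jump w k x = w (Suc k) (S k x) - w (Suc k) x"

text \<open>The backward equation: \<open>w k\<close> averages \<open>w (Suc k)\<close> over the
  next step, so \<open>w k (walk k x \<xi>)\<close> is a martingale up to time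
  \<open>J\<close>.\<close>

definition harmonic :: "(nat \<Rightarrow> 'v \<Rightarrow> real) \<Rightarrow> bool" where
  "harmonic w \<longleftrightarrow> (\<forall>k<J. \<forall>x\<in>V. w k x = (1 - h) * w (Suc k) x + h * w (Suc k) (S k x))"

section \<open>Pathwise properties of the walk and averaging over single coins\<close>

lemma finite_coins: "finite (set_pmf coins)"
proof -
  have "set_pmf coins \<subseteq> PiE_dflt {..<J} False (\<lambda>_. UNIV)"
    unfolding coins_def by (subst set_Pi_pmf) (auto simp: PiE_dflt_def)
  moreover have "finite (PiE_dflt {..<J} False (\<lambda>_. UNIV :: bool set))"
    by (intro finite_PiE_dflt) auto
  ultimately show ?thesis by (rule finite_subset)
qed

lemma integrable_coins: "integrable (measure_pmf coins) (\<Psi> :: _ \<Rightarrow> real)"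
  by (rule integrable_measure_pmf_finite[OF finite_coins])

lemma walk_in: "x \<in> V \<Longrightarrow> walk k x \<xi> \<in> V"
  using bij by (induction k) (auto simp: bij_betw_def)

lemma inj_on_walk: "inj_on (\<lambda>x. walk k x \<xi>) V"
proof (induction k)
  case (Suc k)
  have "inj_on (\<lambda>x. S k (walk k x \<xi>)) V"
    using bij[of k] walk_in inj_onD[OF Suc] by (auto simp: bij_betw_def inj_on_def)
  with Suc show ?case by (cases "\<xi> k") simp_all
qed (simp add: inj_on_def)

lemma surj_walk: "y \<in> V \<Longrightarrow> \<exists>x\<in>V. walk k x \<xi> = y"
proof (induction k arbitrary: y)
  case (Suc k)
  obtain z where "z \<in> V" "S k z = y"
    using Suc.prems bij[of k] unfolding bij_betw_def by (metis imageE)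
  then show ?case
    using Suc by (cases "\<xi> k") fastforce+
qed simp

lemma walk_cong: "(\<And>i. i < k \<Longrightarrow> \<xi> i = \<xi>' i) \<Longrightarrow> walk k x \<xi> = walk k x \<xi>'"
  by (induction k) auto

lemma walk_upd [simp]: "walk k x (\<xi>(k := b)) = walk k x \<xi>"
  by (rule walk_cong) auto

lemma depends_below_upd: "depends_below k \<Psi> \<Longrightarrow> k \<le> i \<Longrightarrow> \<Psi> (\<xi>(i := b)) = \<Psi> \<xi>"
  unfolding depends_below_def by auto

lemma expectation_split_coin:
  assumes "k < J"
  shows "E \<Psi> = (1 - h) * E (\<lambda>\<xi>. \<Psi> (\<xi>(k := False))) + h * E (\<lambda>\<xi>. \<Psi> (\<xi>(k := True)))"
proof -
  define P' where "P' = Pi_pmf ({..<J} - {k}) False (\<lambda>_. bernoulli_pmf h)"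
  have coins: "coins = map_pmf (\<lambda>(y, f). f(k := y)) (pair_pmf (bernoulli_pmf h) P')"
    using Pi_pmf_insert[of "{..<J} - {k}" k False "\<lambda>_. bernoulli_pmf h"] assms
    by (simp add: coins_def P'_def insert_absorb)
  have fin: "finite (set_pmf P')"
  proof -
    have "set_pmf P' \<subseteq> PiE_dflt ({..<J} - {k}) False (\<lambda>_. UNIV)"
      unfolding P'_def by (subst set_Pi_pmf) (auto simp: PiE_dflt_def)
    moreover have "finite (PiE_dflt ({..<J} - {k}) False (\<lambda>_. UNIV :: bool set))"
      by (intro finite_PiE_dflt) auto
    ultimately show ?thesis by (rule finite_subset)
  qed
  have split: "E \<Phi> = (1 - h) * measure_pmf.expectation P' (\<lambda>f. \<Phi> (f(k := False)))
        + h * measure_pmf.expectation P' (\<lambda>f. \<Phi> (f(k := True)))" for \<Phi>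
    using h by (simp add: coins expectation_pair_pmf_finite[OF _ fin])
  \<comment> \<open>\<open>split\<close> is applied to \<open>\<Psi>\<close> and to both overwritten
    versions; in the latter the second overwriting is absorbed and the weights \<open>1 - h\<close>
    and \<open>h\<close> add up to 1.\<close>
  show ?thesis
    unfolding split[of \<Psi>] split[of "\<lambda>\<xi>. \<Psi> (\<xi>(k := b))" for b]
    by (simp add: algebra_simps)
qed

text \<open>The centred coin takes the values \<open>- h\<close> and \<open>1 - h\<close> with
  weights \<open>1 - h\<close> and \<open>h\<close>, independently of the earlier coins.\<close>

lemma expectation_centred_coin:
  assumes "k < J" "depends_below k \<Psi>"
  shows "E (\<lambda>\<xi>. (of_bool (\<xi> k) - h) * \<Psi> \<xi>) = 0"
proof -
  have "E (\<lambda>\<xi>. (of_bool (\<xi> k) - h) * \<Psi> \<xi>) = (1 - h) * E (\<lambda>\<xi>. (- h) * \<Psi> \<xi>) + h * E (\<lambda>\<xi>. (1 - h) * \<Psi> \<xi>)"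
    by (subst expectation_split_coin[OF assms(1)]) (simp add: depends_below_upd[OF assms(2)])
  also have "\<dots> = 0"
    unfolding integral_mult_right_zero by simp
  finally show ?thesis .
qed

text \<open>On \<open>V\<close>, harmonicity reads \<open>w k = w (Suc k) + h * jump w k\<close>;
  subtraction leaves the coin minus its mean.\<close>

lemma martingale_increment:
  assumes "harmonic w" "k < J" "x \<in> V"
  shows "w (Suc k) (walk (Suc k) x \<xi>) - w k (walk k x \<xi>)
    = (of_bool (\<xi> k) - h) * jump w k (walk k x \<xi>)"
  using assms walk_in[OF assms(3), of k \<xi>]
  by (simp add: harmonic_def jump_def algebra_simps)

text \<open>Tower property, by induction downwards from \<open>J\<close>: each step averages out
  coin \<open>k\<close>, on which \<open>\<Psi>\<close> does not depend.\<close>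

lemma expectation_harmonic:
  assumes w: "harmonic w" and x: "x \<in> V" and "k \<le> J" and dep: "depends_below k \<Psi>"
  shows "E (\<lambda>\<xi>. \<Psi> \<xi> * w J (walk J x \<xi>)) = E (\<lambda>\<xi>. \<Psi> \<xi> * w k (walk k x \<xi>))"
  using \<open>k \<le> J\<close> dep
proof (induction rule: inc_induct)
  case (step k)
  have "depends_below (Suc k) \<Psi>"
    using step.prems by (auto simp: depends_below_def)
  then have "E (\<lambda>\<xi>. \<Psi> \<xi> * w J (walk J x \<xi>)) = E (\<lambda>\<xi>. \<Psi> \<xi> * w (Suc k) (walk (Suc k) x \<xi>))"
    by (rule step.IH)
  also have "\<dots> = (1 - h) * E (\<lambda>\<xi>. \<Psi> \<xi> * w (Suc k) (walk k x \<xi>))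
      + h * E (\<lambda>\<xi>. \<Psi> \<xi> * w (Suc k) (S k (walk k x \<xi>)))"
    by (subst expectation_split_coin[OF step.hyps(2)]) (simp add: depends_below_upd[OF step.prems])
  also have "\<dots> = E (\<lambda>\<xi>. (1 - h) * (\<Psi> \<xi> * w (Suc k) (walk k x \<xi>))
      + h * (\<Psi> \<xi> * w (Suc k) (S k (walk k x \<xi>))))"
    by (simp add: integrable_coins)
  also have "\<dots> = E (\<lambda>\<xi>. \<Psi> \<xi> * w k (walk k x \<xi>))"
  proof (intro Bochner_Integration.integral_cong refl)
    fix \<xi>
    have "w k (walk k x \<xi>) = (1 - h) * w (Suc k) (walk k x \<xi>) + h * w (Suc k) (S k (walk k x \<xi>))"
      using w step.hyps(2) walk_in[OF x] unfolding harmonic_def by blast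
    then show "(1 - h) * (\<Psi> \<xi> * w (Suc k) (walk k x \<xi>)) + h * (\<Psi> \<xi> * w (Suc k) (S k (walk k x \<xi>)))
        = \<Psi> \<xi> * w k (walk k x \<xi>)"
      by (simp only:) (simp add: algebra_simps)
  qed
  finally show ?case .
qed simp

text \<open>The \<open>k\<close>-th summand depends on the first \<open>k + 1\<close> coins only, so
  conditioning replaces \<open>v J\<close> by \<open>v (Suc k)\<close>. Averaging over coin
  \<open>k\<close> then leaves its variance \<open>h * (1 - h)\<close> times the product of the two
  jumps.\<close>

lemma expectation_transform:
  assumes u: "harmonic u" and v: "harmonic v" and x: "x \<in> V"
  shows "E (\<lambda>\<xi>. (\<Sum>k<J. \<theta> k (walk k x \<xi>) * (of_bool (\<xi> k) - h) * jump u k (walk k x \<xi>))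
        * v J (walk J x \<xi>))
    = h * (1 - h) * E (\<lambda>\<xi>. \<Sum>k<J. \<theta> k (walk k x \<xi>) * jump u k (walk k x \<xi>) * jump v k (walk k x \<xi>))"
proof -
  have summand: "E (\<lambda>\<xi>. \<theta> k (walk k x \<xi>) * (of_bool (\<xi> k) - h) * jump u k (walk k x \<xi>) * v J (walk J x \<xi>))
    = h * (1 - h) * E (\<lambda>\<xi>. \<theta> k (walk k x \<xi>) * jump u k (walk k x \<xi>) * jump v k (walk k x \<xi>))"
    if k: "k < J" for k
  proof -
    have dep: "depends_below (Suc k)
        (\<lambda>\<xi>. \<theta> k (walk k x \<xi>) * (of_bool (\<xi> k) - h) * jump u k (walk k x \<xi>))"
      unfolding depends_below_def
    proof (intro allI impI)
      fix \<xi> \<xi>' :: "nat \<Rightarrow> bool" assume "\<forall>i<Suc k. \<xi> i = \<xi>' i"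
      then have "walk k x \<xi> = walk k x \<xi>'" "\<xi> k = \<xi>' k"
        by (auto intro: walk_cong)
      then show "\<theta> k (walk k x \<xi>) * (of_bool (\<xi> k) - h) * jump u k (walk k x \<xi>)
          = \<theta> k (walk k x \<xi>') * (of_bool (\<xi>' k) - h) * jump u k (walk k x \<xi>')"
        by simp
    qed
    have "E (\<lambda>\<xi>. \<theta> k (walk k x \<xi>) * (of_bool (\<xi> k) - h) * jump u k (walk k x \<xi>) * v J (walk J x \<xi>))
      = E (\<lambda>\<xi>. \<theta> k (walk k x \<xi>) * (of_bool (\<xi> k) - h) * jump u k (walk k x \<xi>)
            * v (Suc k) (walk (Suc k) x \<xi>))"
      using k by (intro expectation_harmonic[OF v x _ dep]) simp
    also have "\<dots> = (1 - h) * E (\<lambda>\<xi>. \<theta> k (walk k x \<xi>) * (0 - h) * jump u k (walk k x \<xi>)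
            * v (Suc k) (walk k x \<xi>))
        + h * E (\<lambda>\<xi>. \<theta> k (walk k x \<xi>) * (1 - h) * jump u k (walk k x \<xi>)
            * v (Suc k) (S k (walk k x \<xi>)))"
      by (subst expectation_split_coin[OF k]) simp
    also have "\<dots> = E (\<lambda>\<xi>. (1 - h) * (\<theta> k (walk k x \<xi>) * (0 - h) * jump u k (walk k x \<xi>)
            * v (Suc k) (walk k x \<xi>))
        + h * (\<theta> k (walk k x \<xi>) * (1 - h) * jump u k (walk k x \<xi>)
            * v (Suc k) (S k (walk k x \<xi>))))"
      using integrable_coins by (subst Bochner_Integration.integral_add) auto
    also have "\<dots> = E (\<lambda>\<xi>. h * (1 - h) * (\<theta> k (walk k x \<xi>) * jump u k (walk k x \<xi>) * jump v k (walk k x \<xi>)))"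
      unfolding jump_def[of v]
      by (intro Bochner_Integration.integral_cong refl) (simp add: algebra_simps)
    also have "\<dots> = h * (1 - h) * E (\<lambda>\<xi>. \<theta> k (walk k x \<xi>) * jump u k (walk k x \<xi>) * jump v k (walk k x \<xi>))"
      by simp
    finally show ?thesis .
  qed
  show ?thesis
    by (simp add: sum_distrib_right sum_distrib_left Bochner_Integration.integral_sum[OF integrable_coins] summand)
qed

section \<open>Sample space, filtration and martingale differences\<close>

text \<open>
  Sample points are \<open>((s, x), \<xi>)\<close> with a fair sign \<open>s\<close>, a starting point \<open>x\<close> and coins \<open>\<xi>\<close>.
  The sign gives the initial value \<open>s * u 0 x\<close> mean zero, so that it is a martingale difference
  and the full process \<open>s * u k (walk k x \<xi>)\<close> is a sum of martingale differences.
\<close>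

definition sample :: "'v set \<Rightarrow> ((real \<times> 'v) \<times> (nat \<Rightarrow> bool)) pmf" where
  "sample A = pair_pmf (pair_pmf (pmf_of_set {1, -1}) (pmf_of_set A)) coins"

text \<open>Time 0 knows nothing, time 1 the sign and the starting point, time \<open>k + 1\<close>
  also the first \<open>k\<close> coins. This shift makes room for the initial value at index
  1.\<close>

definition agree :: "nat \<Rightarrow> (real \<times> 'v) \<times> (nat \<Rightarrow> bool) \<Rightarrow> (real \<times> 'v) \<times> (nat \<Rightarrow> bool) \<Rightarrow> bool" where
  "agree k z z' \<longleftrightarrow> k = 0 \<or> fst z = fst z' \<and> (\<forall>i<k - 1. snd z i = snd z' i)"

text \<open>The sets are the unions of \<open>agree\<close> classes, so that constancy on the
  classes gives measurability.\<close>

definition history :: "nat \<Rightarrow> ((real \<times> 'v) \<times> (nat \<Rightarrow> bool)) measure" where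
  "history k = sigma UNIV {B. \<forall>z z'. agree k z z' \<longrightarrow> (z \<in> B \<longleftrightarrow> z' \<in> B)}"

lemma space_history [simp]: "space (history k) = UNIV"
  by (simp add: history_def)

lemma sets_history: "sets (history k) = {B. \<forall>z z'. agree k z z' \<longrightarrow> (z \<in> B \<longleftrightarrow> z' \<in> B)}"
proof -
  have "sigma_algebra UNIV {B. \<forall>z z'. agree k z z' \<longrightarrow> (z \<in> B \<longleftrightarrow> z' \<in> B)}"
    unfolding sigma_algebra_iff2 by blast
  then show ?thesis
    unfolding history_def by (simp add: sigma_algebra.sigma_sets_eq)
qed

lemma agree_mono: "j \<le> k \<Longrightarrow> agree k z z' \<Longrightarrow> agree j z z'"
  by (auto simp: agree_def)

lemma measurable_history:
  assumes "\<And>z z'. agree k z z' \<Longrightarrow> f z = f z'"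
  shows "f \<in> borel_measurable (history k)"
  using assms by (intro measurableI) (auto simp: sets_history)

lemma filtration_history: "filtration UNIV history"
  by unfold_locales (simp, unfold sets_history, use agree_mono in blast)

lemma finite_sample:
  assumes "finite A" "A \<noteq> {}"
  shows "finite (set_pmf (sample A))"
  using assms finite_coins by (simp add: sample_def)

lemma expectation_sample:
  assumes A: "finite A" "A \<noteq> {}"
  shows "measure_pmf.expectation (sample A) f
    = (\<Sum>x\<in>A. E (\<lambda>\<xi>. f ((1, x), \<xi>)) + E (\<lambda>\<xi>. f ((-1, x), \<xi>))) / (2 * real (card A))"
proof -
  have "measure_pmf.expectation (sample A) f
      = measure_pmf.expectation (pair_pmf (pmf_of_set {1, -1}) (pmf_of_set A)) (\<lambda>y. E (\<lambda>\<xi>. f (y, \<xi>)))"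
    unfolding sample_def using A finite_coins by (intro expectation_pair_pmf_finite) auto
  also have "\<dots> = measure_pmf.expectation (pmf_of_set {1, -1 :: real})
      (\<lambda>s. measure_pmf.expectation (pmf_of_set A) (\<lambda>x. E (\<lambda>\<xi>. f ((s, x), \<xi>))))"
    using A by (intro expectation_pair_pmf_finite) auto
  also have "\<dots> = (\<Sum>x\<in>A. E (\<lambda>\<xi>. f ((1, x), \<xi>)) + E (\<lambda>\<xi>. f ((-1, x), \<xi>))) / (2 * real (card A))"
    using A by (simp add: integral_pmf_of_set sum.distrib add_divide_distrib)
  finally show ?thesis .
qed

text \<open>Index \<open>k\<close> belongs to coin \<open>k - 2\<close>. The sequence continues by 0
  after \<open>J + 1\<close>, because the martingale difference condition is imposed on all
  indices.\<close>

definition increment :: "(nat \<Rightarrow> 'v \<Rightarrow> real) \<Rightarrow> nat \<Rightarrow> (real \<times> 'v) \<times> (nat \<Rightarrow> bool) \<Rightarrow> real" where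
  "increment u k z = (case z of ((s, x), \<xi>) \<Rightarrow>
     if k = 1 then s * u 0 x
     else if 2 \<le> k \<and> k \<le> J + 1
     then s * (of_bool (\<xi> (k - 2)) - h) * jump u (k - 2) (walk (k - 2) x \<xi>)
     else 0)"

text \<open>The value 0 at index 1 removes the initial value from the transform. At a later index
  \<open>k\<close> the multiplier sees only the coins before \<open>k - 2\<close>, which are known
  at time \<open>k - 1\<close>.\<close>

definition multiplier :: "(nat \<Rightarrow> 'v \<Rightarrow> real) \<Rightarrow> nat \<Rightarrow> (real \<times> 'v) \<times> (nat \<Rightarrow> bool) \<Rightarrow> real" where
  "multiplier \<theta> k z = (case z of ((s, x), \<xi>) \<Rightarrow>
     if k \<le> 1 then 0 else \<theta> (k - 2) (walk (k - 2) x \<xi>))"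

lemma expectation_increment:
  assumes A: "finite A" "A \<noteq> {}" and k: "1 \<le> k"
    and B: "B \<in> sets (history (k - 1))"
  shows "measure_pmf.expectation (sample A) (\<lambda>z. indicator B z * increment u k z) = 0"
proof -
  have sat: "agree (k - 1) z z' \<Longrightarrow> z \<in> B \<longleftrightarrow> z' \<in> B" for z z'
    using B unfolding sets_history by blast
  consider "k = 1" | "2 \<le> k" "k \<le> J + 1" | "k > J + 1" using k by linarith
  then show ?thesis
  proof cases
    \<comment> \<open>\<open>history 0\<close> is trivial, so \<open>B\<close> is empty or
      everything, and the fair sign averages \<open>s * u 0 x\<close> to 0.\<close>
    case 1
    then have "z \<in> B \<longleftrightarrow> z' \<in> B" for z z'
      using sat[of z z'] by (simp add: agree_def)
    then have "B = {} \<or> B = UNIV" by blast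
    then show ?thesis
      using 1 by (auto simp: expectation_sample[OF A] increment_def)
  next
    case 2
    have "E (\<lambda>\<xi>. indicator B ((s, x), \<xi>) * increment u k ((s, x), \<xi>)) = 0" for s x
    proof -
      \<comment> \<open>At time \<open>k - 1\<close> the set \<open>B\<close> involves only coins
        before \<open>k - 2\<close>, so coin \<open>k - 2\<close> is still centred given
        \<open>B\<close>.\<close>
      have "depends_below (k - 2)
          (\<lambda>\<xi>. indicator B ((s, x), \<xi>) * s * jump u (k - 2) (walk (k - 2) x \<xi>))"
        unfolding depends_below_def
      proof (intro allI impI)
        fix \<xi> \<xi>' :: "nat \<Rightarrow> bool" assume eq: "\<forall>i<k - 2. \<xi> i = \<xi>' i"
        then have "agree (k - 1) ((s, x), \<xi>) ((s, x), \<xi>')"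
          by (auto simp: agree_def numeral_2_eq_2)
        from sat[OF this] walk_cong[of "k - 2" \<xi> \<xi>' x] eq
        show "indicator B ((s, x), \<xi>) * s * jump u (k - 2) (walk (k - 2) x \<xi>)
            = indicator B ((s, x), \<xi>') * s * jump u (k - 2) (walk (k - 2) x \<xi>')"
          by (simp add: indicator_def)
      qed
      from expectation_centred_coin[OF _ this] show ?thesis
        using 2 by (simp add: increment_def mult_ac)
    qed
    then show ?thesis
      by (simp add: expectation_sample[OF A])
  qed (simp add: increment_def case_prod_beta)
qed

lemma martingale_difference_increment:
  assumes A: "finite A" "A \<noteq> {}"
  shows "Lp_martingale_difference (measure_pmf (sample A)) history p (increment u)"
  unfolding Lp_martingale_difference_def
proof (intro allI impI conjI)
  fix k :: nat assume k: "1 \<le> k"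
  have int: "integrable (measure_pmf (sample A)) (g :: _ \<Rightarrow> real)" for g
    by (rule integrable_measure_pmf_finite[OF finite_sample[OF A]])
  show "integrable (measure_pmf (sample A)) (\<lambda>x. \<bar>increment u k x\<bar> powr p)"
    by (rule int)
  show "increment u k \<in> borel_measurable (history k)"
  proof (rule measurable_history)
    fix z z' :: "(real \<times> 'v) \<times> (nat \<Rightarrow> bool)" assume agr: "agree k z z'"
    obtain s x \<xi> \<xi>' where z: "z = ((s, x), \<xi>)" "z' = ((s, x), \<xi>')"
      using agr k by (cases z; cases z') (auto simp: agree_def)
    have "walk (k - 2) x \<xi> = walk (k - 2) x \<xi>'"
      using agr k by (intro walk_cong) (auto simp: agree_def z)
    moreover have "\<xi> (k - 2) = \<xi>' (k - 2)" if "2 \<le> k"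
      using agr that by (auto simp: agree_def z)
    ultimately show "increment u k z = increment u k z'"
      by (simp add: increment_def z)
  qed
  have sub: "subalgebra (measure_pmf (sample A)) (history (k - 1))"
    by (simp add: subalgebra_def)
  interpret finite_measure_subalgebra "measure_pmf (sample A)" "history (k - 1)"
    by unfold_locales (rule sub)
  show "AE x in measure_pmf (sample A). real_cond_exp (sample A) (history (k - 1)) (increment u k) x = 0"
  proof (rule real_cond_exp_charact)
    fix B assume "B \<in> sets (history (k - 1))"
    from expectation_increment[OF A k this]
    show "(\<integral>x\<in>B. increment u k x \<partial>measure_pmf (sample A)) = (\<integral>x\<in>B. 0 \<partial>measure_pmf (sample A))"
      by (simp add: set_lebesgue_integral_def)
  qed (simp_all add: int)
qed

lemma predictable_multiplier:
  assumes "\<And>k x. \<theta> k x \<in> {0, 1}"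
  shows "predictable_01 M history (multiplier \<theta>)"
  unfolding predictable_01_def
proof (intro allI impI conjI ballI)
  fix k :: nat assume k: "1 \<le> k"
  show "multiplier \<theta> k \<in> borel_measurable (history (k - 1))"
  proof (rule measurable_history)
    fix z z' :: "(real \<times> 'v) \<times> (nat \<Rightarrow> bool)" assume agr: "agree (k - 1) z z'"
    show "multiplier \<theta> k z = multiplier \<theta> k z'"
    proof (cases "k = 1")
      case False
      then obtain s x \<xi> \<xi>' where z: "z = ((s, x), \<xi>)" "z' = ((s, x), \<xi>')"
        using agr k by (cases z; cases z') (auto simp: agree_def)
      have "walk (k - 2) x \<xi> = walk (k - 2) x \<xi>'"
        using agr k False by (intro walk_cong) (auto simp: agree_def z numeral_2_eq_2)
      then show ?thesis by (simp add: multiplier_def z)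
    qed (simp add: multiplier_def case_prod_beta)
  qed
qed (use assms in \<open>auto simp: multiplier_def case_prod_beta\<close>)

text \<open>The increments telescope, and the initial value at index 1 cancels the lower end of the
  telescope.\<close>

lemma sum_increment:
  assumes "harmonic u" "x \<in> V"
  shows "(\<Sum>k=1..J + 1. increment u k ((s, x), \<xi>)) = s * u J (walk J x \<xi>)"
proof -
  have "(\<Sum>k=1..J + 1. increment u k ((s, x), \<xi>))
      = increment u 1 ((s, x), \<xi>) + (\<Sum>k<J. increment u (k + 2) ((s, x), \<xi>))"
    by (rule sum_from_one)
  also have "(\<Sum>k<J. increment u (k + 2) ((s, x), \<xi>))
      = (\<Sum>k<J. s * u (Suc k) (walk (Suc k) x \<xi>) - s * u k (walk k x \<xi>))"
    using martingale_increment[OF assms(1) _ assms(2), of _ \<xi>]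
    by (intro sum.cong refl) (simp add: increment_def mult.assoc flip: right_diff_distrib del: walk.simps)
  also have "\<dots> = s * u J (walk J x \<xi>) - s * u 0 x"
    by (subst sum_lessThan_telescope) simp
  finally show ?thesis by (simp add: increment_def)
qed

lemma sum_multiplier_increment:
  "(\<Sum>k=1..J + 1. multiplier \<theta> k ((s, x), \<xi>) * increment u k ((s, x), \<xi>))
    = s * (\<Sum>k<J. \<theta> k (walk k x \<xi>) * (of_bool (\<xi> k) - h) * jump u k (walk k x \<xi>))"
proof -
  have "(\<Sum>k=1..J + 1. multiplier \<theta> k ((s, x), \<xi>) * increment u k ((s, x), \<xi>))
      = (\<Sum>k<J. multiplier \<theta> (k + 2) ((s, x), \<xi>) * increment u (k + 2) ((s, x), \<xi>))"
    by (subst sum_from_one) (simp add: multiplier_def)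
  also have "\<dots> = (\<Sum>k<J. s * (\<theta> k (walk k x \<xi>) * (of_bool (\<xi> k) - h) * jump u k (walk k x \<xi>)))"
    by (intro sum.cong refl) (simp add: multiplier_def increment_def mult_ac)
  finally show ?thesis by (simp add: sum_distrib_left)
qed

text \<open>
  Since \<open>x \<mapsto> walk J x \<xi>\<close> is injective, the uniform law on \<open>A\<close> is pushed to a law of density at most
  \<open>1 / card A\<close>.
\<close>
lemma Lp_norm_terminal:
  assumes A: "finite A" "A \<noteq> {}" "A \<subseteq> V" and p: "0 < p"
    and W: "\<And>B. finite B \<Longrightarrow> B \<subseteq> V \<Longrightarrow> (\<Sum>x\<in>B. \<bar>w J x\<bar> powr p) \<le> W"
    and Z: "\<And>s x \<xi>. x \<in> A \<Longrightarrow> \<bar>Z ((s, x), \<xi>)\<bar> = \<bar>s\<bar> * \<bar>w J (walk J x \<xi>)\<bar>"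
  shows "Lp_norm (measure_pmf (sample A)) p Z \<le> (W / card A) powr (1 / p)"
proof -
  have card: "card A > 0" using A by (simp add: card_gt_0_iff)
  have bd: "(\<Sum>x\<in>A. \<bar>w J (walk J x \<xi>)\<bar> powr p) \<le> W" for \<xi>
  proof -
    have "(\<Sum>x\<in>A. \<bar>w J (walk J x \<xi>)\<bar> powr p) = (\<Sum>y\<in>(\<lambda>x. walk J x \<xi>) ` A. \<bar>w J y\<bar> powr p)"
      by (subst sum.reindex) (use inj_on_subset[OF inj_on_walk A(3)] in auto)
    also have "\<dots> \<le> W"
      using A walk_in by (intro W) auto
    finally show ?thesis .
  qed
  have "measure_pmf.expectation (sample A) (\<lambda>z. \<bar>Z z\<bar> powr p)
      = (\<Sum>x\<in>A. E (\<lambda>\<xi>. \<bar>w J (walk J x \<xi>)\<bar> powr p)) / card A"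
    by (simp add: expectation_sample[OF A(1,2)] Z flip: sum_distrib_left)
  also have "\<dots> = E (\<lambda>\<xi>. \<Sum>x\<in>A. \<bar>w J (walk J x \<xi>)\<bar> powr p) / card A"
    by (simp add: Bochner_Integration.integral_sum[OF integrable_coins])
  also have "\<dots> \<le> E (\<lambda>\<xi>. W) / card A"
    using card bd by (intro divide_right_mono integral_mono integrable_coins) auto
  finally have "measure_pmf.expectation (sample A) (\<lambda>z. \<bar>Z z\<bar> powr p) \<le> W / card A"
    by simp
  then show ?thesis
    unfolding Lp_norm_def using p by (intro powr_mono2) auto
qed

text \<open>\<open>U\<close> and \<open>W\<close> bound power sums over all finite subsets, so no
  integral over an infinite \<open>V\<close> occurs. The factor \<open>1 / card A\<close> on both
  sides cancels, which makes the bound independent of the starting law.\<close>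

lemma walk_bound:
  assumes choi: "choi_bound TYPE((real \<times> 'v) \<times> (nat \<Rightarrow> bool)) p C" and C: "0 \<le> C"
    and p: "1 < p" and q: "q = p / (p - 1)" and V: "V \<noteq> {}"
    and u: "harmonic u" and v: "harmonic v"
    and U: "\<And>B. finite B \<Longrightarrow> B \<subseteq> V \<Longrightarrow> (\<Sum>x\<in>B. \<bar>u J x\<bar> powr p) \<le> U"
    and W: "\<And>B. finite B \<Longrightarrow> B \<subseteq> V \<Longrightarrow> (\<Sum>x\<in>B. \<bar>v J x\<bar> powr q) \<le> W"
    and F: "\<And>k. finite (F k)" "\<And>k. F k \<subseteq> V" and \<sigma>: "\<sigma> = 1 \<or> \<sigma> = -1"
  shows "h * (1 - h) * (\<Sum>k<J. \<Sum>x\<in>F k. max (\<sigma> * (jump u k x * jump v k x)) 0)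
    \<le> C * (U powr (1 / p) * W powr (1 / q))"
proof -
  obtain x0 where x0: "x0 \<in> V" using V by blast
  \<comment> \<open>For each coin outcome and time, injectivity of the walk leaves finitely many
    starting points that land in \<open>F k\<close>; \<open>x0\<close> makes \<open>A\<close>
    nonempty.\<close>
  define A where "A = insert x0 (\<Union>\<xi>\<in>set_pmf coins. \<Union>k<J. {x \<in> V. walk k x \<xi> \<in> F k})"
  have fin1: "finite {x \<in> V. walk k x \<xi> \<in> F k}" for k \<xi>
    using finite_vimage_IntI[OF F(1)[of k] inj_on_walk[of k \<xi>]]
    by (rule rev_finite_subset) auto
  have A: "finite A" "A \<noteq> {}" "A \<subseteq> V"
    using fin1 finite_coins x0 by (auto simp: A_def)
  define cA where "cA = real (card A)"
  have cA: "cA > 0" using A by (simp add: cA_def card_gt_0_iff)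
  \<comment> \<open>The multiplier is a function of the current position alone, hence
    predictable.\<close>
  define \<theta> where "\<theta> k x = (if \<sigma> * (jump u k x * jump v k x) > 0 then 1 else 0 :: real)" for k x
  define \<phi> where "\<phi> k x = max (\<sigma> * (jump u k x * jump v k x)) 0" for k x
  have \<theta>: "\<sigma> * (\<theta> k x * jump u k x * jump v k x) = \<phi> k x" for k x
    by (simp add: \<theta>_def \<phi>_def)
  let ?M = "measure_pmf (sample A)"
  define Y where "Y z = (\<Sum>k=1..J + 1. multiplier \<theta> k z * increment u k z)" for z
  define D where "D z = (\<Sum>k=1..J + 1. increment u k z)" for z
  \<comment> \<open>The sign \<open>s\<close> meets the same sign in \<open>Y\<close> and squares to
    1; \<open>\<sigma>\<close> makes the selected products of jumps positive.\<close>
  define Z where "Z z = (case z of ((s, x), \<xi>) \<Rightarrow> \<sigma> * (s * v J (walk J x \<xi>)))" for z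
  have q1: "1 < q" and pq: "1 / p + 1 / q = 1" using p by (auto simp: q field_simps)
  have U0: "0 \<le> U" "0 \<le> W" using U[of "{}"] W[of "{}"] by auto

  have lower: "h * (1 - h) * (\<Sum>k<J. \<Sum>x\<in>F k. \<phi> k x) / cA \<le> measure_pmf.expectation (sample A) (\<lambda>z. Y z * Z z)"
  proof -
    have YZ: "E (\<lambda>\<xi>. Y ((s, x), \<xi>) * Z ((s, x), \<xi>))
        = h * (1 - h) * E (\<lambda>\<xi>. \<Sum>k<J. \<phi> k (walk k x \<xi>))"
      if "x \<in> A" "s = 1 \<or> s = -1" for s x
    proof -
      have "x \<in> V" using that A by auto
      have "E (\<lambda>\<xi>. Y ((s, x), \<xi>) * Z ((s, x), \<xi>)) = E (\<lambda>\<xi>. \<sigma> *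
         ((\<Sum>k<J. \<theta> k (walk k x \<xi>) * (of_bool (\<xi> k) - h) * jump u k (walk k x \<xi>)) * v J (walk J x \<xi>)))"
        using that(2) unfolding Y_def Z_def sum_multiplier_increment
        by (intro Bochner_Integration.integral_cong refl) auto
      also have "\<dots> = \<sigma> * (h * (1 - h) *
          E (\<lambda>\<xi>. \<Sum>k<J. \<theta> k (walk k x \<xi>) * jump u k (walk k x \<xi>) * jump v k (walk k x \<xi>)))"
        unfolding integral_mult_right_zero expectation_transform[OF u v \<open>x \<in> V\<close>] ..
      also have "\<dots> = h * (1 - h) *
          E (\<lambda>\<xi>. \<sigma> * (\<Sum>k<J. \<theta> k (walk k x \<xi>) * jump u k (walk k x \<xi>) * jump v k (walk k x \<xi>)))"
        by simp
      also have "\<dots> = h * (1 - h) * E (\<lambda>\<xi>. \<Sum>k<J. \<phi> k (walk k x \<xi>))"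
        by (simp only: sum_distrib_left \<theta>)
      finally show ?thesis .
    qed
    \<comment> \<open>For every single coin outcome the walk at time \<open>k\<close> maps
      \<open>A\<close> onto a superset of \<open>F k\<close>, and \<open>\<phi>\<close> is
      nonnegative; the distribution of the walk never has to be computed.\<close>
    have "(\<Sum>k<J. \<Sum>x\<in>F k. \<phi> k x) \<le> (\<Sum>x\<in>A. \<Sum>k<J. \<phi> k (walk k x \<xi>))" if "\<xi> \<in> set_pmf coins" for \<xi>
    proof -
      have "(\<Sum>x\<in>F k. \<phi> k x) \<le> (\<Sum>x\<in>A. \<phi> k (walk k x \<xi>))" if "k < J" for k
      proof -
        have "F k \<subseteq> (\<lambda>x. walk k x \<xi>) ` A"
        proof
          fix y assume y: "y \<in> F k"
          obtain x where "x \<in> V" "walk k x \<xi> = y" using surj_walk[of y k \<xi>] F y by blast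
          then show "y \<in> (\<lambda>x. walk k x \<xi>) ` A"
            using y \<open>\<xi> \<in> set_pmf coins\<close> \<open>k < J\<close> by (auto simp: A_def)
        qed
        then have "(\<Sum>x\<in>F k. \<phi> k x) \<le> (\<Sum>y\<in>(\<lambda>x. walk k x \<xi>) ` A. \<phi> k y)"
          using A by (intro sum_mono2) (auto simp: \<phi>_def)
        also have "\<dots> = (\<Sum>x\<in>A. \<phi> k (walk k x \<xi>))"
          by (subst sum.reindex) (use inj_on_subset[OF inj_on_walk A(3)] in auto)
        finally show ?thesis .
      qed
      then show ?thesis
        by (subst sum.swap) (auto intro: sum_mono)
    qed
    then have "E (\<lambda>_. \<Sum>k<J. \<Sum>x\<in>F k. \<phi> k x) \<le> E (\<lambda>\<xi>. \<Sum>x\<in>A. \<Sum>k<J. \<phi> k (walk k x \<xi>))"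
      by (intro integral_mono_AE integrable_coins) (simp add: AE_measure_pmf_iff)
    then have "h * (1 - h) * (\<Sum>k<J. \<Sum>x\<in>F k. \<phi> k x) / cA
        \<le> h * (1 - h) * E (\<lambda>\<xi>. \<Sum>x\<in>A. \<Sum>k<J. \<phi> k (walk k x \<xi>)) / cA"
      using h cA by (intro divide_right_mono mult_left_mono) auto
    also have "\<dots> = h * (1 - h) * (\<Sum>x\<in>A. E (\<lambda>\<xi>. \<Sum>k<J. \<phi> k (walk k x \<xi>))) / cA"
      by (subst Bochner_Integration.integral_sum[OF integrable_coins]) simp
    also have "\<dots> = measure_pmf.expectation (sample A) (\<lambda>z. Y z * Z z)"
      by (simp add: expectation_sample[OF A(1,2)] YZ cA_def flip: sum_distrib_left)
    finally show ?thesis .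
  qed
  also have "\<dots> \<le> Lp_norm ?M p Y * Lp_norm ?M q Z"
    by (rule Holder_inequality_pmf[OF finite_sample[OF A(1,2)] p q])
  also have "\<dots> \<le> (C * Lp_norm ?M p D) * Lp_norm ?M q Z"
  proof (rule mult_right_mono)
    have "predictable_01 ?M history (multiplier \<theta>)"
      by (rule predictable_multiplier) (simp add: \<theta>_def)
    moreover have "subalgebra ?M (history k)" for k
      by (simp add: subalgebra_def)
    moreover have "filtration (space ?M) history" "1 \<le> J + 1"
      using filtration_history by simp_all
    ultimately show "Lp_norm ?M p Y \<le> C * Lp_norm ?M p D"
      using choi martingale_difference_increment[OF A(1,2), of p u] prob_space_measure_pmf[of "sample A"]
      unfolding choi_bound_def Y_def[abs_def] D_def[abs_def] by blast
  qed (simp add: Lp_norm_def)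
  also have "\<dots> \<le> (C * (U / cA) powr (1 / p)) * (W / cA) powr (1 / q)"
  proof (intro mult_mono mult_left_mono)
    show "Lp_norm ?M p D \<le> (U / cA) powr (1 / p)"
      unfolding cA_def
    proof (rule Lp_norm_terminal[OF A, where w = u])
      show "\<bar>D ((s, x), \<xi>)\<bar> = \<bar>s\<bar> * \<bar>u J (walk J x \<xi>)\<bar>" if "x \<in> A" for s x \<xi>
        using sum_increment[OF u, of x s \<xi>] that A unfolding D_def by (auto simp: abs_mult)
    qed (use p U in simp_all)
    show "Lp_norm ?M q Z \<le> (W / cA) powr (1 / q)"
      unfolding cA_def
    proof (rule Lp_norm_terminal[OF A, where w = v])
      show "\<bar>Z ((s, x), \<xi>)\<bar> = \<bar>s\<bar> * \<bar>v J (walk J x \<xi>)\<bar>" for s x \<xi>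
        using \<sigma> by (auto simp: Z_def abs_mult)
    qed (use q1 W in simp_all)
  qed (use C in \<open>auto simp: Lp_norm_def\<close>)
  also have "\<dots> = C * (U powr (1 / p) * W powr (1 / q)) / cA"
  proof -
    have "cA powr (1 / p) * cA powr (1 / q) = cA"
      using cA pq by (simp flip: powr_add)
    then show ?thesis
      using U0 cA by (simp add: powr_divide)
  qed
  finally show ?thesis
    using cA by (simp add: \<phi>_def divide_le_cancel)
qed

end

section \<open>Heat flow generated by finitely many measure preserving jumps\<close>

locale jump_flow =
  fixes V :: "'v set" and S :: "nat \<Rightarrow> 'v \<Rightarrow> 'v" and R :: nat
  assumes bij: "\<And>r. r < R \<Longrightarrow> bij_betw (S r) V V" and R: "0 < R"
begin

definition grad :: "nat \<Rightarrow> ('v \<Rightarrow> real) \<Rightarrow> 'v \<Rightarrow> real" where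
  "grad r \<phi> x = \<phi> (S r x) - \<phi> x"

definition gen :: "('v \<Rightarrow> real) \<Rightarrow> 'v \<Rightarrow> real" where
  "gen \<phi> x = (\<Sum>r<R. grad r \<phi> x)"

definition heat :: "('v \<Rightarrow> real) \<Rightarrow> real \<Rightarrow> 'v \<Rightarrow> real" where
  "heat \<phi> t x = (\<Sum>k. t ^ k / fact k * (gen ^^ k) \<phi> x)"

text \<open>
  One Euler step for each jump in turn; \<open>R\<close> successive steps approximate the heat flow over time \<open>h\<close>.
\<close>
primrec scheme :: "real \<Rightarrow> ('v \<Rightarrow> real) \<Rightarrow> nat \<Rightarrow> 'v \<Rightarrow> real" where
  "scheme h \<phi> 0 = \<phi>"
| "scheme h \<phi> (Suc m) = (\<lambda>x. scheme h \<phi> m x + h * grad (m mod R) (scheme h \<phi> m) x)"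

definition bounded_by :: "real \<Rightarrow> ('v \<Rightarrow> real) \<Rightarrow> bool" where
  "bounded_by B \<phi> \<longleftrightarrow> (\<forall>x\<in>V. \<bar>\<phi> x\<bar> \<le> B)"

section \<open>The exponential series of the generator in the supremum norm\<close>

lemma bounded_byD: "bounded_by B \<phi> \<Longrightarrow> x \<in> V \<Longrightarrow> \<bar>\<phi> x\<bar> \<le> B"
  by (simp add: bounded_by_def)

lemma S_in: "r < R \<Longrightarrow> x \<in> V \<Longrightarrow> S r x \<in> V"
  using bij by (auto simp: bij_betw_def)

lemma bounded_by_grad:
  fixes B :: real
  assumes "bounded_by B \<phi>" "r < R"
  shows "bounded_by (2 * B) (grad r \<phi>)"
  unfolding bounded_by_def
proof
  fix x assume "x \<in> V"
  with bounded_byD[OF assms(1), of x] bounded_byD[OF assms(1), of "S r x"] S_in[OF assms(2)]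
  show "\<bar>grad r \<phi> x\<bar> \<le> 2 * B" by (auto simp: grad_def)
qed

lemma bounded_by_sum:
  fixes B :: real
  assumes "\<And>i. i \<in> I \<Longrightarrow> bounded_by B (\<phi> i)"
  shows "bounded_by (card I * B) (\<lambda>x. \<Sum>i\<in>I. \<phi> i x)"
  unfolding bounded_by_def
proof
  fix x assume "x \<in> V"
  then have "\<bar>\<Sum>i\<in>I. \<phi> i x\<bar> \<le> (\<Sum>i\<in>I. B)"
    using assms bounded_byD by (intro order.trans[OF sum_abs] sum_mono) blast
  then show "\<bar>\<Sum>i\<in>I. \<phi> i x\<bar> \<le> card I * B" by simp
qed

lemma bounded_by_gen:
  fixes B :: real
  assumes "bounded_by B \<phi>"
  shows "bounded_by (2 * R * B) (gen \<phi>)"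
  using bounded_by_sum[of "{..<R}" "2 * B" "\<lambda>r. grad r \<phi>"] bounded_by_grad[OF assms]
  by (simp add: gen_def[abs_def] mult_ac)

lemma bounded_by_gen_power:
  fixes B :: real
  assumes "bounded_by B \<phi>"
  shows "bounded_by ((2 * R) ^ k * B) ((gen ^^ k) \<phi>)"
proof (induction k)
  case (Suc k)
  from bounded_by_gen[OF this] show ?case by (simp add: mult_ac)
qed (use assms in simp)

text \<open>\<open>gen\<close> has supremum norm at most \<open>2 * R\<close>, so the series is
  dominated by an exponential series.\<close>

lemma abs_heat_term_le:
  fixes B t :: real
  assumes "bounded_by B \<phi>" "x \<in> V"
  shows "\<bar>t ^ k / fact k * (gen ^^ k) \<phi> x\<bar> \<le> B * ((2 * R * \<bar>t\<bar>) ^ k /\<^sub>R fact k)"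
proof -
  have "\<bar>t ^ k / fact k * (gen ^^ k) \<phi> x\<bar> = \<bar>t\<bar> ^ k / fact k * \<bar>(gen ^^ k) \<phi> x\<bar>"
    by (simp add: abs_mult power_abs)
  also have "\<dots> \<le> \<bar>t\<bar> ^ k / fact k * ((2 * R) ^ k * B)"
    by (intro mult_left_mono bounded_byD[OF bounded_by_gen_power[OF assms(1)] assms(2)]) simp
  also have "\<dots> = B * ((2 * R * \<bar>t\<bar>) ^ k /\<^sub>R fact k)"
    by (simp add: power_mult_distrib divide_inverse mult_ac)
  finally show ?thesis .
qed

lemma summable_heat_abs:
  fixes B t :: real
  assumes "bounded_by B \<phi>" "x \<in> V"
  shows "summable (\<lambda>k. \<bar>t ^ k / fact k * (gen ^^ k) \<phi> x\<bar>)"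
proof (rule summable_comparison_test')
  show "summable (\<lambda>k. B * ((2 * R * \<bar>t\<bar>) ^ k /\<^sub>R fact k))"
    by (rule summable_mult[OF summable_exp_generic])
  show "norm \<bar>t ^ k / fact k * (gen ^^ k) \<phi> x\<bar> \<le> B * ((2 * R * \<bar>t\<bar>) ^ k /\<^sub>R fact k)" for k
    using abs_heat_term_le[OF assms] by simp
qed

lemma summable_heat:
  fixes B t :: real
  assumes "bounded_by B \<phi>" "x \<in> V"
  shows "summable (\<lambda>k. t ^ k / fact k * (gen ^^ k) \<phi> x)"
  using summable_heat_abs[OF assms, of t] by (rule summable_rabs_cancel)

lemma abs_heat_le:
  fixes B t :: real
  assumes "bounded_by B \<phi>" "x \<in> V" "0 \<le> t"
  shows "\<bar>heat \<phi> t x\<bar> \<le> B * exp (2 * R * t)"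
proof -
  have "\<bar>heat \<phi> t x\<bar> \<le> (\<Sum>k. \<bar>t ^ k / fact k * (gen ^^ k) \<phi> x\<bar>)"
    unfolding heat_def by (rule summable_rabs[OF summable_heat_abs[OF assms(1,2)]])
  also have "\<dots> \<le> (\<Sum>k. B * ((2 * R * t) ^ k /\<^sub>R fact k))"
  proof (rule suminf_le[OF _ summable_heat_abs[OF assms(1,2)]])
    show "summable (\<lambda>k. B * ((2 * R * t) ^ k /\<^sub>R fact k))"
      by (rule summable_mult[OF summable_exp_generic])
    show "\<bar>t ^ k / fact k * (gen ^^ k) \<phi> x\<bar> \<le> B * ((2 * R * t) ^ k /\<^sub>R fact k)" for k
      using abs_heat_term_le[OF assms(1,2), of t k] assms(3) by simp
  qed
  also have "\<dots> = B * exp (2 * R * t)"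
    unfolding exp_def by (rule suminf_mult[OF summable_exp_generic])
  finally show ?thesis .
qed

text \<open>\<open>gen\<close> is a finite sum of differences and therefore commutes with the
  series. Together with \<open>DERIV_heat\<close> this is the heat equation.\<close>

lemma heat_gen:
  fixes B t :: real
  assumes "bounded_by B \<phi>" "x \<in> V"
  shows "heat (gen \<phi>) t x = gen (heat \<phi> t) x"
proof -
  have "(gen ^^ k) (gen \<phi>) x = (\<Sum>r<R. (gen ^^ k) \<phi> (S r x) - (gen ^^ k) \<phi> x)" for k
  proof -
    have "(gen ^^ k) (gen \<phi>) x = gen ((gen ^^ k) \<phi>) x"
      by (simp add: funpow_swap1)
    then show ?thesis by (simp add: gen_def grad_def)
  qed
  then have "heat (gen \<phi>) t x = (\<Sum>k. \<Sum>r<R. t ^ k / fact k * (gen ^^ k) \<phi> (S r x) - t ^ k / fact k * (gen ^^ k) \<phi> x)"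
    unfolding heat_def by (simp add: sum_distrib_left right_diff_distrib)
  also have "\<dots> = (\<Sum>r<R. \<Sum>k. t ^ k / fact k * (gen ^^ k) \<phi> (S r x) - t ^ k / fact k * (gen ^^ k) \<phi> x)"
    using assms S_in by (intro suminf_sum summable_diff summable_heat) auto
  also have "\<dots> = (\<Sum>r<R. grad r (heat \<phi> t) x)"
    unfolding grad_def heat_def
    by (intro sum.cong refl suminf_diff[symmetric] summable_heat[OF assms(1)]) (use assms S_in in auto)
  also have "\<dots> = gen (heat \<phi> t) x"
    by (simp add: gen_def)
  finally show ?thesis .
qed

text \<open>For fixed \<open>x\<close> this is an everywhere convergent power series in
  \<open>t\<close>; termwise differentiation turns iterate \<open>k + 1\<close> on
  \<open>\<phi>\<close> into iterate \<open>k\<close> on \<open>gen \<phi>\<close>.\<close>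

lemma DERIV_heat:
  fixes B t :: real
  assumes "bounded_by B \<phi>" "x \<in> V"
  shows "((\<lambda>t. heat \<phi> t x) has_real_derivative heat (gen \<phi>) t x) (at t)"
proof -
  define c where "c k = (gen ^^ k) \<phi> x / fact k" for k
  have "summable (\<lambda>k. c k * y ^ k)" for y
    using summable_heat[OF assms, of y] by (simp add: c_def mult_ac)
  from termdiffs_strong_converges_everywhere[OF this, of t]
  have "((\<lambda>t. \<Sum>k. c k * t ^ k) has_real_derivative (\<Sum>k. diffs c k * t ^ k)) (at t)" .
  moreover have "diffs c k * t ^ k = t ^ k / fact k * (gen ^^ k) (gen \<phi>) x" for k
  proof -
    have "real (Suc k) / fact (Suc k) = 1 / fact k"
      by (simp del: of_nat_Suc)
    then show ?thesis
      by (simp add: diffs_def c_def funpow_swap1 mult_ac del: of_nat_Suc fact_Suc)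
        (simp add: divide_inverse mult_ac del: of_nat_Suc fact_Suc)
  qed
  ultimately show ?thesis
    by (simp add: heat_def c_def mult_ac)
qed

lemma heat_lipschitz:
  fixes B s t T :: real
  assumes \<phi>: "bounded_by B \<phi>" and x: "x \<in> V" and t: "0 \<le> s" "s \<le> t" "t \<le> T"
  shows "\<bar>heat \<phi> t x - heat \<phi> s x\<bar> \<le> (t - s) * (2 * R * B * exp (2 * R * T))"
proof (cases "s = t")
  case False
  with t have "s < t" by simp
  obtain z where z: "s < z" "z < t" "heat \<phi> t x - heat \<phi> s x = (t - s) * heat (gen \<phi>) z x"
    using MVT2[OF \<open>s < t\<close> DERIV_heat[OF \<phi> x]] by blast
  have "0 \<le> B" using bounded_byD[OF \<phi> x] by linarith
  have "\<bar>heat (gen \<phi>) z x\<bar> \<le> 2 * R * B * exp (2 * R * z)"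
    using abs_heat_le[OF bounded_by_gen[OF \<phi>] x, of z] z t by simp
  also have "\<dots> \<le> 2 * R * B * exp (2 * R * T)"
    using z t \<open>0 \<le> B\<close> by (intro mult_left_mono) (auto intro: mult_left_mono)
  finally show ?thesis
    using \<open>s < t\<close> by (simp add: z(3) abs_mult mult_left_mono)
qed simp

text \<open>The mean value theorem, then the Lipschitz bound for \<open>gen \<phi>\<close>: each of
  the two generators costs a factor \<open>2 * R\<close>.\<close>

lemma heat_taylor:
  fixes B h t T :: real
  assumes \<phi>: "bounded_by B \<phi>" and x: "x \<in> V" and t: "0 \<le> t" "0 < h" "t + h \<le> T"
  shows "\<bar>heat \<phi> (t + h) x - heat \<phi> t x - h * gen (heat \<phi> t) x\<bar>
    \<le> h\<^sup>2 * (4 * (real R)\<^sup>2 * (B * exp (2 * R * T)))"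
proof -
  obtain z where z: "t < z" "z < t + h"
    "heat \<phi> (t + h) x - heat \<phi> t x = h * heat (gen \<phi>) z x"
    using MVT2[OF _ DERIV_heat[OF \<phi> x], of t "t + h"] t by auto
  have "0 \<le> B" using bounded_byD[OF \<phi> x] by linarith
  have "\<bar>heat (gen \<phi>) z x - heat (gen \<phi>) t x\<bar> \<le> (z - t) * (2 * R * (2 * R * B) * exp (2 * R * T))"
    using z t by (intro heat_lipschitz bounded_by_gen \<phi> x) auto
  also have "\<dots> \<le> h * (2 * R * (2 * R * B) * exp (2 * R * T))"
    using z \<open>0 \<le> B\<close> by (intro mult_right_mono) auto
  finally have "h * \<bar>heat (gen \<phi>) z x - heat (gen \<phi>) t x\<bar> \<le> h * (h * (2 * R * (2 * R * B) * exp (2 * R * T)))"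
    using t by (intro mult_left_mono) auto
  moreover have "heat \<phi> (t + h) x - heat \<phi> t x - h * gen (heat \<phi> t) x
      = h * (heat (gen \<phi>) z x - heat (gen \<phi>) t x)"
    by (simp add: z(3) heat_gen[OF \<phi> x] right_diff_distrib)
  ultimately show ?thesis
    using t by (simp add: abs_mult power2_eq_square mult_ac)
qed

text \<open>For \<open>0 \<le> h \<le> 1\<close> the step is a convex combination of
  \<open>\<phi>\<close> and its translate. This is the stability of the scheme, used for the
  solution and for its error.\<close>

lemma bounded_by_euler_step:
  fixes B h :: real
  assumes "bounded_by B \<phi>" "r < R" "0 \<le> h" "h \<le> 1"
  shows "bounded_by B (\<lambda>x. \<phi> x + h * grad r \<phi> x)"
  unfolding bounded_by_def
proof
  fix x assume x: "x \<in> V"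
  have "\<phi> x + h * grad r \<phi> x = (1 - h) * \<phi> x + h * \<phi> (S r x)"
    by (simp add: grad_def algebra_simps)
  also have "\<bar>\<dots>\<bar> \<le> (1 - h) * \<bar>\<phi> x\<bar> + h * \<bar>\<phi> (S r x)\<bar>"
    using assms by (intro order.trans[OF abs_triangle_ineq]) (simp add: abs_mult)
  also have "\<dots> \<le> (1 - h) * B + h * B"
    using assms x S_in bounded_byD by (intro add_mono mult_left_mono) auto
  finally show "\<bar>\<phi> x + h * grad r \<phi> x\<bar> \<le> B" by (simp add: algebra_simps)
qed

lemma bounded_by_scheme:
  fixes B h :: real
  assumes "bounded_by B \<phi>" "0 \<le> h" "h \<le> 1"
  shows "bounded_by B (scheme h \<phi> m)"
  using assms R by (induction m) (auto intro!: bounded_by_euler_step)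

text \<open>First order expansion of the scheme inside a round of \<open>R\<close> steps.\<close>
definition interpolant :: "real \<Rightarrow> ('v \<Rightarrow> real) \<Rightarrow> nat \<Rightarrow> 'v \<Rightarrow> real" where
  "interpolant h \<phi> m x = heat \<phi> (real (m div R) * h) x
     + h * (\<Sum>r<m mod R. grad r (heat \<phi> (real (m div R) * h)) x)"

text \<open>The local error has two sources: the gradient of the earlier first order terms of the
  round, and the Taylor remainder of the heat flow when the round closes.\<close>

lemma interpolant_consistent:
  fixes B h T :: real
  assumes \<phi>: "bounded_by B \<phi>" and x: "x \<in> V" and h: "0 < h" and T: "real (Suc m div R) * h \<le> T"
  shows "\<bar>interpolant h \<phi> m x + h * grad (m mod R) (interpolant h \<phi> m) x - interpolant h \<phi> (Suc m) x\<bar>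
    \<le> h\<^sup>2 * ((4 * R + 4 * (real R)\<^sup>2) * (B * exp (2 * R * T)))"
proof -
  define t where "t = real (m div R) * h"
  define r where "r = m mod R"
  define H where "H = B * exp (2 * R * T)"
  define w where "w = heat \<phi> t"
  define G where "G y = (\<Sum>i<r. grad i w y)" for y
  have r: "r < R" using R by (simp add: r_def)
  have t0: "0 \<le> t" using h by (simp add: t_def)
  have tT: "t \<le> T"
  proof -
    have "t \<le> real (Suc m div R) * h"
      unfolding t_def using h by (intro mult_right_mono) (auto intro: div_le_mono)
    with T show ?thesis by simp
  qed
  have B0: "0 \<le> B" using bounded_byD[OF \<phi> x] by linarith
  have w: "bounded_by H w"
    unfolding bounded_by_def
  proof
    fix y assume "y \<in> V"
    from abs_heat_le[OF \<phi> this t0] have "\<bar>w y\<bar> \<le> B * exp (2 * R * t)" by (simp add: w_def)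
    also have "\<dots> \<le> H"
      unfolding H_def using tT B0 by (intro mult_left_mono) (auto intro: mult_left_mono)
    finally show "\<bar>w y\<bar> \<le> H" .
  qed
  have H0: "0 \<le> H" using bounded_byD[OF w x] by linarith
  have "bounded_by (real (card {..<r}) * (2 * H)) G"
    unfolding G_def using r by (intro bounded_by_sum bounded_by_grad[OF w]) auto
  then have "bounded_by (2 * (real r * (2 * H))) (grad r G)"
    using r by (intro bounded_by_grad) auto
  then have "\<bar>grad r G x\<bar> \<le> 2 * (real r * (2 * H))"
    using x by (rule bounded_byD)
  also have "\<dots> \<le> 4 * R * H"
    using r H0 by (auto intro: mult_right_mono)
  finally have G: "\<bar>grad r G x\<bar> \<le> 4 * R * H" .
  have interp: "interpolant h \<phi> m = (\<lambda>y. w y + h * G y)"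
    by (rule ext) (simp add: interpolant_def w_def G_def t_def r_def)
  then have step: "interpolant h \<phi> m x + h * grad (m mod R) (interpolant h \<phi> m) x
      = w x + h * (\<Sum>i<Suc r. grad i w x) + h\<^sup>2 * grad r G x"
    by (simp add: grad_def G_def power2_eq_square algebra_simps flip: r_def)
  \<comment> \<open>When the round closes, the sum of gradients is the full \<open>gen\<close> and
    the interpolant restarts from the heat flow at \<open>t + h\<close>; inside a round the two
    expressions coincide.\<close>
  have "\<bar>w x + h * (\<Sum>i<Suc r. grad i w x) - interpolant h \<phi> (Suc m) x\<bar> \<le> h\<^sup>2 * (4 * (real R)\<^sup>2 * H)"
  proof (cases "Suc r = R")
    case True
    then have "Suc m mod R = 0" by (simp add: mod_Suc r_def)
    moreover from this have m: "Suc m div R = Suc (m div R)" by (simp add: div_Suc)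
    ultimately have "interpolant h \<phi> (Suc m) x = heat \<phi> (t + h) x"
      by (simp add: interpolant_def t_def algebra_simps)
    then have "w x + h * (\<Sum>i<Suc r. grad i w x) - interpolant h \<phi> (Suc m) x
        = - (heat \<phi> (t + h) x - heat \<phi> t x - h * gen (heat \<phi> t) x)"
      by (simp only: True gen_def w_def)
    moreover have "t + h \<le> T" using T unfolding m t_def by (simp add: algebra_simps)
    ultimately show ?thesis
      using heat_taylor[OF \<phi> x t0 h, of T] by (simp only: abs_minus_cancel H_def)
  next
    case False
    then have m: "Suc m mod R = Suc r" by (simp add: mod_Suc r_def)
    then have "Suc m div R = m div R" by (simp add: div_Suc)
    then have "interpolant h \<phi> (Suc m) x = w x + h * (\<Sum>i<Suc r. grad i w x)"
      by (simp add: interpolant_def m w_def t_def)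
    then show ?thesis using H0 by simp
  qed
  moreover have "h\<^sup>2 * \<bar>grad r G x\<bar> \<le> h\<^sup>2 * (4 * R * H)"
    using G by (intro mult_left_mono) auto
  then have "\<bar>h\<^sup>2 * grad r G x\<bar> \<le> h\<^sup>2 * (4 * R * H)"
    by (simp add: abs_mult)
  ultimately show ?thesis
    unfolding step H_def[symmetric] by (simp add: distrib_right distrib_left)
qed

text \<open>Stability plus consistency: an Euler step does not enlarge the accumulated error, so
  \<open>m\<close> local errors simply add up.\<close>

lemma scheme_interpolant:
  fixes B h T :: real
  assumes \<phi>: "bounded_by B \<phi>" and h: "0 < h" "h \<le> 1" and T: "real (m div R) * h \<le> T"
  shows "bounded_by (m * (h\<^sup>2 * ((4 * R + 4 * (real R)\<^sup>2) * (B * exp (2 * R * T)))))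
    (\<lambda>x. scheme h \<phi> m x - interpolant h \<phi> m x)"
  using T
proof (induction m)
  case 0
  have "heat \<phi> 0 x = \<phi> x" for x
    unfolding heat_def using powser_zero[of "\<lambda>k. (gen ^^ k) \<phi> x / fact k"] by (simp add: mult_ac)
  then show ?case by (simp add: bounded_by_def interpolant_def)
next
  case (Suc m)
  define c where "c = h\<^sup>2 * ((4 * R + 4 * (real R)\<^sup>2) * (B * exp (2 * R * T)))"
  define e where "e x = scheme h \<phi> m x - interpolant h \<phi> m x" for x
  have "real (m div R) * h \<le> real (Suc m div R) * h"
    using h by (intro mult_right_mono) (auto intro: div_le_mono)
  with Suc have "bounded_by (m * c) e"
    by (simp add: c_def e_def[abs_def])
  then have e: "bounded_by (m * c) (\<lambda>x. e x + h * grad (m mod R) e x)"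
    using h R by (intro bounded_by_euler_step) auto
  show ?case
    unfolding bounded_by_def c_def[symmetric]
  proof
    fix x assume x: "x \<in> V"
    have "scheme h \<phi> (Suc m) x - interpolant h \<phi> (Suc m) x = (e x + h * grad (m mod R) e x)
      + (interpolant h \<phi> m x + h * grad (m mod R) (interpolant h \<phi> m) x - interpolant h \<phi> (Suc m) x)"
      by (simp add: e_def grad_def algebra_simps)
    also have "\<bar>\<dots>\<bar> \<le> m * c + c"
      using bounded_byD[OF e x] interpolant_consistent[OF \<phi> x h(1) Suc.prems]
      unfolding c_def[symmetric] by linarith
    finally show "\<bar>scheme h \<phi> (Suc m) x - interpolant h \<phi> (Suc m) x\<bar> \<le> real (Suc m) * c"
      by (simp add: algebra_simps)
  qed
qed

text \<open>At most \<open>R * T / h\<close> steps with local error of order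
  \<open>h\<^sup>2\<close> cost order \<open>h\<close>. Passing from the interpolant to the heat
  flow at the start of the round, and from there to time \<open>t\<close>, costs
  \<open>2 * R * H * h\<close> each.\<close>

lemma scheme_heat:
  fixes B h t T :: real
  assumes \<phi>: "bounded_by B \<phi>" and h: "0 < h" "h \<le> 1" and x: "x \<in> V"
    and T: "real (m div R) * h + h \<le> T" and t: "real (m div R) * h \<le> t" "t \<le> real (m div R) * h + h"
  shows "\<bar>scheme h \<phi> m x - heat \<phi> t x\<bar>
    \<le> (R * T * (4 * R + 4 * (real R)\<^sup>2) + 4 * R) * (B * exp (2 * R * T)) * h"
proof -
  define s where "s = real (m div R) * h"
  define H where "H = B * exp (2 * R * T)"
  have s0: "0 \<le> s" using h by (simp add: s_def)
  have sT: "s + h \<le> T" "s \<le> T" "t \<le> T" "t - s \<le> h" "s \<le> t" using T h t by (auto simp: s_def)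
  have B0: "0 \<le> B" using bounded_byD[OF \<phi> x] by linarith
  have w: "bounded_by H (heat \<phi> s)"
    unfolding bounded_by_def
  proof
    fix y assume "y \<in> V"
    from abs_heat_le[OF \<phi> this s0] have "\<bar>heat \<phi> s y\<bar> \<le> B * exp (2 * R * s)" .
    also have "\<dots> \<le> H"
      unfolding H_def using sT B0 by (intro mult_left_mono) (auto intro: mult_left_mono)
    finally show "\<bar>heat \<phi> s y\<bar> \<le> H" .
  qed
  have H0: "0 \<le> H" using bounded_byD[OF w x] by linarith
  have 1: "\<bar>scheme h \<phi> m x - interpolant h \<phi> m x\<bar> \<le> (R * T * h) * ((4 * R + 4 * (real R)\<^sup>2) * H)"
  proof -
    have "m \<le> R * (m div R) + R"
      using mult_div_mod_eq[of R m] mod_less_divisor[OF R, of m] by linarith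
    then have "real m \<le> R * (m div R) + R" by (metis of_nat_add of_nat_le_iff of_nat_mult)
    then have "real m * h \<le> (R * (m div R) + R) * h"
      using h by (intro mult_right_mono) auto
    also have "\<dots> = R * (s + h)" by (simp add: s_def algebra_simps)
    also have "\<dots> \<le> R * T" using sT by (intro mult_left_mono) auto
    finally have "real m * h * h * ((4 * R + 4 * (real R)\<^sup>2) * H) \<le> R * T * h * ((4 * R + 4 * (real R)\<^sup>2) * H)"
      using h H0 by (intro mult_right_mono) auto
    moreover have "\<bar>scheme h \<phi> m x - interpolant h \<phi> m x\<bar> \<le> m * (h\<^sup>2 * ((4 * R + 4 * (real R)\<^sup>2) * H))"
      using bounded_byD[OF scheme_interpolant[OF \<phi> h, of m T] x] sT by (simp add: s_def H_def)
    ultimately show ?thesis by (simp add: power2_eq_square mult_ac)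
  qed
  have 2: "\<bar>interpolant h \<phi> m x - heat \<phi> s x\<bar> \<le> h * (R * (2 * H))"
  proof -
    have "bounded_by (real (card {..<m mod R}) * (2 * H)) (\<lambda>x. \<Sum>r<m mod R. grad r (heat \<phi> s) x)"
      using mod_less_divisor[OF R, of m] by (intro bounded_by_sum bounded_by_grad[OF w]) auto
    from bounded_byD[OF this x]
    have "\<bar>\<Sum>r<m mod R. grad r (heat \<phi> s) x\<bar> \<le> real (m mod R) * (2 * H)" by simp
    also have "\<dots> \<le> R * (2 * H)"
      using H0 mod_less_divisor[OF R, of m] by (intro mult_right_mono) auto
    finally have "h * \<bar>\<Sum>r<m mod R. grad r (heat \<phi> s) x\<bar> \<le> h * (R * (2 * H))"
      using h by (intro mult_left_mono) auto
    then show ?thesis using h by (simp add: interpolant_def s_def abs_mult)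
  qed
  have "\<bar>heat \<phi> t x - heat \<phi> s x\<bar> \<le> (t - s) * (2 * R * B * exp (2 * R * T))"
    using sT s0 by (intro heat_lipschitz[OF \<phi> x]) auto
  also have "\<dots> \<le> h * (2 * R * B * exp (2 * R * T))"
    using sT B0 by (intro mult_right_mono) auto
  also have "\<dots> = h * (R * (2 * H))" by (simp add: H_def)
  finally have 3: "\<bar>heat \<phi> t x - heat \<phi> s x\<bar> \<le> h * (R * (2 * H))" .
  have "(R * T * (4 * R + 4 * (real R)\<^sup>2) + 4 * R) * H * h
      = (R * T * h) * ((4 * R + 4 * (real R)\<^sup>2) * H) + h * (R * (2 * H)) + h * (R * (2 * H))"
    by (simp add: algebra_simps)
  with 1 2 3 show ?thesis unfolding H_def[symmetric] by linarith
qed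

end

section \<open>Passage to continuous time\<close>

text \<open>The positive part is 1-Lipschitz. The bounds are asked of \<open>a'\<close> and
  \<open>b\<close> because these survive in the splitting
  \<open>(a - a') * b + a' * (b - b')\<close>.\<close>

lemma abs_pos_part_product_diff_le:
  fixes a b a' b' \<sigma> K e :: real
  assumes "\<bar>a - a'\<bar> \<le> e" "\<bar>b - b'\<bar> \<le> e" "\<bar>a'\<bar> \<le> K" "\<bar>b\<bar> \<le> K" "\<sigma> = 1 \<or> \<sigma> = -1"
  shows "max (\<sigma> * (a * b)) 0 \<le> max (\<sigma> * (a' * b')) 0 + 2 * K * e"
proof -
  have "a * b - a' * b' = (a - a') * b + a' * (b - b')"
    by (simp add: algebra_simps)
  also have "\<bar>\<dots>\<bar> \<le> e * K + K * e"
    using assms by (intro order.trans[OF abs_triangle_ineq] add_mono) (auto simp: abs_mult intro!: mult_mono)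
  finally show ?thesis using assms(5) by (auto simp: abs_le_iff max_def algebra_simps)
qed

lemma nn_integral_le_step_sum:
  fixes f :: "real \<Rightarrow> real" and h :: real
  assumes f: "f \<in> borel_measurable borel" and h: "0 \<le> h"
    and le: "\<And>j t. j < K \<Longrightarrow> real j * h \<le> t \<Longrightarrow> t < real (Suc j) * h \<Longrightarrow> f t \<le> a j"
    and a: "\<And>j. j < K \<Longrightarrow> 0 \<le> a j"
  shows "(\<integral>\<^sup>+t\<in>{0..<real K * h}. ennreal (f t) \<partial>lborel) \<le> ennreal (\<Sum>j<K. h * a j)"
  using le a
proof (induction K)
  case (Suc K)
  have eq: "{0..<real (Suc K) * h} = {0..<real K * h} \<union> {real K * h..<real (Suc K) * h}"
    using h by (intro ivl_disj_un_two(3)[symmetric] mult_right_mono) auto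
  have "(\<integral>\<^sup>+t\<in>{0..<real (Suc K) * h}. ennreal (f t) \<partial>lborel)
      = (\<integral>\<^sup>+t\<in>{0..<real K * h}. ennreal (f t) \<partial>lborel)
        + (\<integral>\<^sup>+t\<in>{real K * h..<real (Suc K) * h}. ennreal (f t) \<partial>lborel)"
    unfolding eq using f by (intro nn_integral_disjoint_pair) auto
  also have "(\<integral>\<^sup>+t\<in>{real K * h..<real (Suc K) * h}. ennreal (f t) \<partial>lborel)
      \<le> (\<integral>\<^sup>+t. ennreal (a K) * indicator {real K * h..<real (Suc K) * h} t \<partial>lborel)"
    using Suc.prems(1)[of K] by (intro nn_integral_mono) (auto simp: indicator_def intro: ennreal_leI)
  also have "\<dots> = ennreal (a K) * ennreal h"
    using h by (simp add: nn_integral_cmult_indicator algebra_simps)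
  also have "\<dots> = ennreal (h * a K)"
    using Suc.prems(2)[of K] h by (simp add: ennreal_mult mult.commute)
  also have "(\<integral>\<^sup>+t\<in>{0..<real K * h}. ennreal (f t) \<partial>lborel) \<le> ennreal (\<Sum>j<K. h * a j)"
    using Suc by auto
  also have "ennreal (\<Sum>j<K. h * a j) + ennreal (h * a K) = ennreal (\<Sum>j<Suc K. h * a j)"
    using h Suc.prems(2) by (subst ennreal_plus[symmetric]) (auto intro!: sum_nonneg)
  finally show ?case by (simp add: add_right_mono)
qed simp

context jump_flow
begin

text \<open>An Euler step is the averaging in \<open>harmonic\<close>, read from a later to an
  earlier walk time. Hence the index \<open>J - k\<close> and the reversed cyclic order of the
  jumps; reindexing the sum undoes the reversal.\<close>

lemma scheme_bound:
  fixes h C p q U W \<sigma> :: real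
  assumes choi: "choi_bound TYPE((real \<times> 'v) \<times> (nat \<Rightarrow> bool)) p C" and C: "0 \<le> C"
    and p: "1 < p" and q: "q = p / (p - 1)" and V: "V \<noteq> {}" and h: "0 < h" "h < 1"
    and U: "\<And>B. finite B \<Longrightarrow> B \<subseteq> V \<Longrightarrow> (\<Sum>x\<in>B. \<bar>\<phi> x\<bar> powr p) \<le> U"
    and W: "\<And>B. finite B \<Longrightarrow> B \<subseteq> V \<Longrightarrow> (\<Sum>x\<in>B. \<bar>\<psi> x\<bar> powr q) \<le> W"
    and F: "finite F" "F \<subseteq> V" and \<sigma>: "\<sigma> = 1 \<or> \<sigma> = -1"
  shows "h * (1 - h) * (\<Sum>m<J. \<Sum>x\<in>F.
      max (\<sigma> * (grad (m mod R) (scheme h \<phi> m) x * grad (m mod R) (scheme h \<psi> m) x)) 0)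
    \<le> C * (U powr (1 / p) * W powr (1 / q))"
proof -
  interpret W: lazy_walk V "\<lambda>k. S ((J - Suc k) mod R)" h J
    using bij R h by unfold_locales auto
  have har: "W.harmonic (\<lambda>k. scheme h \<eta> (J - k))" for \<eta>
    unfolding W.harmonic_def
  proof (intro allI impI ballI)
    fix k x assume "k < J"
    then have "J - k = Suc (J - Suc k)" by simp
    then show "scheme h \<eta> (J - k) x = (1 - h) * scheme h \<eta> (J - Suc k) x
        + h * scheme h \<eta> (J - Suc k) (S ((J - Suc k) mod R) x)"
      by (simp add: grad_def algebra_simps del: Suc_diff_Suc)
  qed
  have jump: "W.jump (\<lambda>k. scheme h \<eta> (J - k)) k = grad ((J - Suc k) mod R) (scheme h \<eta> (J - Suc k))" for \<eta> k
    by (rule ext) (simp add: W.jump_def grad_def)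
  have "h * (1 - h) * (\<Sum>k<J. \<Sum>x\<in>F. max (\<sigma> *
      (W.jump (\<lambda>k. scheme h \<phi> (J - k)) k x * W.jump (\<lambda>k. scheme h \<psi> (J - k)) k x)) 0)
    \<le> C * (U powr (1 / p) * W powr (1 / q))"
    using U W F by (intro W.walk_bound[OF choi C p q V har har _ _ _ _ \<sigma>]) simp_all
  then show ?thesis
    unfolding jump by (subst (asm) sum.nat_diff_reindex)
qed

section \<open>Energy density and the limit of small time steps\<close>

lemma borel_measurable_heat:
  fixes B :: real
  assumes "bounded_by B \<phi>" "x \<in> V"
  shows "(\<lambda>t. heat \<phi> t x) \<in> borel_measurable borel"
  by (intro borel_measurable_continuous_onI continuous_at_imp_continuous_on ballI
      DERIV_isCont[OF DERIV_heat[OF assms]])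

definition energy :: "real \<Rightarrow> ('v \<Rightarrow> real) \<Rightarrow> ('v \<Rightarrow> real) \<Rightarrow> nat \<Rightarrow> real \<Rightarrow> 'v \<Rightarrow> real" where
  "energy \<sigma> \<phi> \<psi> r t x = max (\<sigma> * (grad r (heat \<phi> t) x * grad r (heat \<psi> t) x)) 0"

lemma energy_nonneg [simp]: "0 \<le> energy \<sigma> \<phi> \<psi> r t x"
  by (simp add: energy_def)

lemma borel_measurable_energy:
  fixes B B' :: real
  assumes "bounded_by B \<phi>" "bounded_by B' \<psi>" "x \<in> V" "r < R"
  shows "(\<lambda>t. energy \<sigma> \<phi> \<psi> r t x) \<in> borel_measurable borel"
proof -
  have [measurable]: "(\<lambda>t. heat \<phi> t y) \<in> borel_measurable borel" "(\<lambda>t. heat \<psi> t y) \<in> borel_measurable borel"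
    if "y \<in> V" for y
    using assms that by (blast intro: borel_measurable_heat)+
  show ?thesis
    unfolding energy_def grad_def using assms S_in[OF assms(4,3)] by measurable
qed

lemma energy_le_scheme:
  fixes B B' T :: real
  assumes \<phi>: "bounded_by B \<phi>" and \<psi>: "bounded_by B \<psi>" and \<sigma>: "\<sigma> = 1 \<or> \<sigma> = -1"
  obtains c where "0 \<le> c" "\<And>h m t x. 0 < h \<Longrightarrow> h \<le> 1 \<Longrightarrow> x \<in> V \<Longrightarrow> real (m div R) * h + h \<le> T \<Longrightarrow>
    real (m div R) * h \<le> t \<Longrightarrow> t \<le> real (m div R) * h + h \<Longrightarrow> energy \<sigma> \<phi> \<psi> (m mod R) t x
    \<le> max (\<sigma> * (grad (m mod R) (scheme h \<phi> m) x * grad (m mod R) (scheme h \<psi> m) x)) 0 + c * h"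
proof
  define H where "H = \<bar>B\<bar> * exp (2 * R * \<bar>T\<bar>)"
  define c where "c = (R * \<bar>T\<bar> * (4 * R + 4 * (real R)\<^sup>2) + 4 * R) * H"
  have H0: "0 \<le> H" by (simp add: H_def)
  have c0: "0 \<le> c" using H0 by (simp add: c_def)
  have BH: "\<bar>B\<bar> \<le> H" unfolding H_def using mult_left_mono[of 1 "exp (2 * R * \<bar>T\<bar>)" "\<bar>B\<bar>"] by simp
  \<comment> \<open>With gradients bounded by \<open>2 * H\<close> and gradient errors by
    \<open>2 * c * h\<close>, the product estimate gives
    \<open>2 * (2 * H) * (2 * c * h)\<close>.\<close>
  show "0 \<le> 8 * H * c" using H0 c0 by simp
  fix h t x :: real and m :: nat and y
  assume h: "0 < h" "h \<le> 1" and y: "y \<in> V" and T: "real (m div R) * h + h \<le> T"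
    and t: "real (m div R) * h \<le> t" "t \<le> real (m div R) * h + h"
  define r where "r = m mod R"
  have r: "r < R" using R by (simp add: r_def)
  have t0: "0 \<le> t" "t \<le> \<bar>T\<bar>" "0 \<le> T"
  proof -
    have "0 \<le> real (m div R) * h" using h by simp
    then show "0 \<le> t" "t \<le> \<bar>T\<bar>" "0 \<le> T" using t T h by linarith+
  qed
  have bdB: "bounded_by \<bar>B\<bar> \<eta>" if "bounded_by B \<eta>" for \<eta>
    using that by (force simp: bounded_by_def)
  have close: "\<bar>grad r (heat \<eta> t) y - grad r (scheme h \<eta> m) y\<bar> \<le> 2 * (c * h)" if "bounded_by B \<eta>" for \<eta>
  proof -
    have "\<bar>scheme h \<eta> m z - heat \<eta> t z\<bar> \<le> c * h" if "z \<in> V" for z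
      using scheme_heat[OF bdB[OF \<open>bounded_by B \<eta>\<close>] h that T t] t0 by (simp add: c_def H_def)
    from this[OF y] this[OF S_in[OF r y]] show ?thesis
      by (auto simp: grad_def)
  qed
  have "\<bar>grad r (scheme h \<phi> m) y\<bar> \<le> 2 * \<bar>B\<bar>"
    using h r by (intro bounded_byD[OF bounded_by_grad y] bounded_by_scheme bdB \<phi>) auto
  also have "\<dots> \<le> 2 * H" using BH by simp
  finally have 1: "\<bar>grad r (scheme h \<phi> m) y\<bar> \<le> 2 * H" .
  have "\<bar>heat \<psi> t z\<bar> \<le> H" if "z \<in> V" for z
  proof -
    have "\<bar>heat \<psi> t z\<bar> \<le> \<bar>B\<bar> * exp (2 * R * t)"
      by (rule abs_heat_le[OF bdB[OF \<psi>] that t0(1)])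
    also have "\<dots> \<le> H"
      unfolding H_def using t0 by (intro mult_left_mono) (auto intro: mult_left_mono)
    finally show ?thesis .
  qed
  then have 2: "\<bar>grad r (heat \<psi> t) y\<bar> \<le> 2 * H"
    using y S_in[OF r y] r by (intro bounded_byD[OF bounded_by_grad y]) (auto simp: bounded_by_def)
  show "energy \<sigma> \<phi> \<psi> (m mod R) t y
    \<le> max (\<sigma> * (grad (m mod R) (scheme h \<phi> m) y * grad (m mod R) (scheme h \<psi> m) y)) 0 + 8 * H * c * h"
    using abs_pos_part_product_diff_le[OF close[OF \<phi>] close[OF \<psi>] 1 2 \<sigma>]
    unfolding energy_def r_def[symmetric] by (simp add: mult_ac)
qed

lemma energy_bound_finite:
  fixes C p q U W \<sigma> B T :: real
  assumes choi: "choi_bound TYPE((real \<times> 'v) \<times> (nat \<Rightarrow> bool)) p C" and C: "0 \<le> C"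
    and p: "1 < p" and q: "q = p / (p - 1)" and V: "V \<noteq> {}"
    and U: "\<And>B. finite B \<Longrightarrow> B \<subseteq> V \<Longrightarrow> (\<Sum>x\<in>B. \<bar>\<phi> x\<bar> powr p) \<le> U"
    and W: "\<And>B. finite B \<Longrightarrow> B \<subseteq> V \<Longrightarrow> (\<Sum>x\<in>B. \<bar>\<psi> x\<bar> powr q) \<le> W"
    and F: "finite F" "F \<subseteq> V" and \<sigma>: "\<sigma> = 1 \<or> \<sigma> = -1"
    and \<phi>: "bounded_by B \<phi>" and \<psi>: "bounded_by B \<psi>" and T: "0 < T"
  shows "(\<integral>\<^sup>+t\<in>{0..<T}. ennreal (\<Sum>r<R. \<Sum>x\<in>F. energy \<sigma> \<phi> \<psi> r t x) \<partial>lborel)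
    \<le> ennreal (C * (U powr (1 / p) * W powr (1 / q)))"
proof -
  define Q where "Q = C * (U powr (1 / p) * W powr (1 / q))"
  obtain c where c: "0 \<le> c" "\<And>h m t x. 0 < h \<Longrightarrow> h \<le> 1 \<Longrightarrow> x \<in> V \<Longrightarrow> real (m div R) * h + h \<le> T \<Longrightarrow>
    real (m div R) * h \<le> t \<Longrightarrow> t \<le> real (m div R) * h + h \<Longrightarrow> energy \<sigma> \<phi> \<psi> (m mod R) t x
    \<le> max (\<sigma> * (grad (m mod R) (scheme h \<phi> m) x * grad (m mod R) (scheme h \<psi> m) x)) 0 + c * h"
    using energy_le_scheme[OF \<phi> \<psi> \<sigma>] by blast
  define I where "I = (\<integral>\<^sup>+t\<in>{0..<T}. ennreal (\<Sum>r<R. \<Sum>x\<in>F. energy \<sigma> \<phi> \<psi> r t x) \<partial>lborel)"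
  define c' where "c' = R * card F * c"
  \<comment> \<open>\<open>K\<close> rounds of length \<open>h = T / K\<close>, where
    \<open>T < K\<close> gives \<open>h < 1\<close>. The walk contributes
    \<open>Q / (1 - h)\<close>, the approximation errors add up to
    \<open>T * c' * h\<close>.\<close>
  have le: "I \<le> ennreal (Q / (1 - T / K) + T * (c' * (T / K)))" if K: "T < real K" for K :: nat
  proof -
    define h where "h = T / K"
    have h: "0 < h" "h < 1" and Kh: "real K * h = T" using K T by (auto simp: h_def)
    define s where "s m = (\<Sum>x\<in>F. max (\<sigma> * (grad (m mod R) (scheme h \<phi> m) x * grad (m mod R) (scheme h \<psi> m) x)) 0)" for m
    \<comment> \<open>Scheme step \<open>j * R + r\<close> applies jump \<open>r\<close> in round
      \<open>j\<close>; \<open>c' * h\<close> absorbs the error over all jumps and all points of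
      \<open>F\<close>.\<close>
    define a where "a j = (\<Sum>r<R. s (j * R + r)) + c' * h" for j
    have s0: "0 \<le> s m" for m by (auto simp: s_def intro: sum_nonneg)
    have c'0: "0 \<le> c'" using c(1) by (simp add: c'_def)
    have meas: "(\<lambda>t. \<Sum>r<R. \<Sum>x\<in>F. energy \<sigma> \<phi> \<psi> r t x) \<in> borel_measurable borel"
      using F by (intro borel_measurable_sum borel_measurable_energy[OF \<phi> \<psi>]) auto
    have "(\<integral>\<^sup>+t\<in>{0..<real K * h}. ennreal (\<Sum>r<R. \<Sum>x\<in>F. energy \<sigma> \<phi> \<psi> r t x) \<partial>lborel)
        \<le> ennreal (\<Sum>j<K. h * a j)"
    proof (rule nn_integral_le_step_sum[OF meas])
      fix j t assume j: "j < K" and t: "real j * h \<le> t" "t < real (Suc j) * h"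
      have "real (Suc j) * h \<le> real K * h" using j h by (intro mult_right_mono) auto
      then have jT: "real j * h + h \<le> T" unfolding Kh by (simp add: algebra_simps)
      have "(\<Sum>x\<in>F. energy \<sigma> \<phi> \<psi> r t x) \<le> s (j * R + r) + card F * (c * h)" if r: "r < R" for r
      proof -
        have "(j * R + r) div R = j" "(j * R + r) mod R = r" using r by auto
        then have "(\<Sum>x\<in>F. energy \<sigma> \<phi> \<psi> r t x) \<le> (\<Sum>x\<in>F. max (\<sigma> * (grad r (scheme h \<phi> (j * R + r)) x
            * grad r (scheme h \<psi> (j * R + r)) x)) 0 + c * h)"
          using c(2)[of h _ "j * R + r" t] h jT t F by (intro sum_mono) (auto simp: algebra_simps)
        also have "\<dots> = s (j * R + r) + card F * (c * h)"
          using r by (simp add: s_def sum.distrib)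
        finally show ?thesis .
      qed
      then have "(\<Sum>r<R. \<Sum>x\<in>F. energy \<sigma> \<phi> \<psi> r t x) \<le> (\<Sum>r<R. s (j * R + r) + card F * (c * h))"
        by (intro sum_mono) auto
      then show "(\<Sum>r<R. \<Sum>x\<in>F. energy \<sigma> \<phi> \<psi> r t x) \<le> a j"
        by (simp add: a_def sum.distrib c'_def mult_ac)
    next
      show "0 \<le> a j" for j using s0 c'0 h by (auto simp: a_def intro!: add_nonneg_nonneg sum_nonneg)
    qed (use h in auto)
    also have "(\<Sum>j<K. h * a j) = h * (\<Sum>j<K. \<Sum>r<R. s (j * R + r)) + T * (c' * h)"
      by (simp add: a_def sum.distrib distrib_left sum_distrib_left[symmetric] Kh[symmetric] mult_ac)
    also have "(\<Sum>j<K. \<Sum>r<R. s (j * R + r)) = (\<Sum>m<K * R. s m)"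
    proof -
      have "(\<Sum>r<R. s (j * R + r)) = sum s {j * R..<j * R + R}" for j
        using sum.shift_bounds_nat_ivl[where g = s and m = 0 and k = "j * R" and n = R] by (simp add: lessThan_atLeast0 add.commute)
      then show ?thesis by (simp add: sum.nat_group)
    qed
    also have "h * (\<Sum>m<K * R. s m) \<le> Q / (1 - h)"
      using scheme_bound[OF choi C p q V h U W F \<sigma>, where J = "K * R"] h
      by (simp add: s_def Q_def pos_le_divide_eq mult_ac)
    finally show ?thesis
      by (simp add: I_def Kh ennreal_leI) (simp add: h_def)
  qed
  have "(\<lambda>K. ennreal (Q / (1 - T / real K) + T * (c' * (T / real K)))) \<longlonglongrightarrow> ennreal (Q / (1 - 0) + T * (c' * 0))"
    by (intro tendsto_intros lim_const_over_n) auto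
  moreover have "eventually (\<lambda>K. I \<le> ennreal (Q / (1 - T / real K) + T * (c' * (T / real K)))) sequentially"
    using eventually_gt_at_top[of "nat \<lceil>T\<rceil>"] by eventually_elim (rule le, linarith)
  ultimately have "I \<le> ennreal (Q / (1 - 0) + T * (c' * 0))"
    by (intro tendsto_lowerbound) auto
  then show ?thesis by (simp add: I_def Q_def)
qed

text \<open>The finite bound does not depend on \<open>T\<close> or on the finite set, so both are
  exhausted simultaneously by monotone convergence.\<close>

lemma energy_bound:
  fixes C p q U W \<sigma> :: real
  assumes choi: "choi_bound TYPE((real \<times> 'v) \<times> (nat \<Rightarrow> bool)) p C" and C: "0 \<le> C"
    and p: "1 < p" and q: "q = p / (p - 1)" and V: "V \<noteq> {}" "countable V"
    and U: "\<And>B. finite B \<Longrightarrow> B \<subseteq> V \<Longrightarrow> (\<Sum>x\<in>B. \<bar>\<phi> x\<bar> powr p) \<le> U"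
    and W: "\<And>B. finite B \<Longrightarrow> B \<subseteq> V \<Longrightarrow> (\<Sum>x\<in>B. \<bar>\<psi> x\<bar> powr q) \<le> W"
    and \<sigma>: "\<sigma> = 1 \<or> \<sigma> = -1"
  shows "(\<Sum>r<R. \<integral>\<^sup>+t\<in>{0..}. (\<integral>\<^sup>+x. ennreal (energy \<sigma> \<phi> \<psi> r t x) \<partial>count_space V) \<partial>lborel)
    \<le> ennreal (C * (U powr (1 / p) * W powr (1 / q)))"
proof -
  have q1: "1 < q" using p by (simp add: q field_simps)
  \<comment> \<open>Power sums over singletons already bound every value, which puts the data in the
    domain of the supremum norm estimates.\<close>
  have bdd: "bounded_by (X powr (1 / s)) \<eta>"
    if "\<And>B. finite B \<Longrightarrow> B \<subseteq> V \<Longrightarrow> (\<Sum>x\<in>B. \<bar>\<eta> x\<bar> powr s) \<le> X" "1 < s" for X s \<eta>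
    unfolding bounded_by_def
  proof
    fix x assume "x \<in> V"
    then have "(\<bar>\<eta> x\<bar> powr s) powr (1 / s) \<le> X powr (1 / s)"
      using that(1)[of "{x}"] that(2) by (intro powr_mono2) auto
    then show "\<bar>\<eta> x\<bar> \<le> X powr (1 / s)" using that(2) by (simp add: powr_powr)
  qed
  define B where "B = max (U powr (1 / p)) (W powr (1 / q))"
  have \<phi>: "bounded_by B \<phi>" and \<psi>: "bounded_by B \<psi>"
    using bdd[OF U p] bdd[OF W q1] unfolding bounded_by_def B_def by (auto simp: le_max_iff_disj)
  define F where "F n = {x \<in> V. to_nat_on V x < n}" for n
  have fin: "finite (F n)" for n
    by (rule inj_on_finite[of "to_nat_on V" _ "{..<n}"])
       (use inj_on_to_nat_on[OF V(2)] in \<open>auto simp: F_def intro: inj_on_subset\<close>)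
  define G where "G t x = (\<Sum>r<R. ennreal (energy \<sigma> \<phi> \<psi> r t x))" for t x
  define \<Phi> where "\<Phi> n t = (\<Sum>x\<in>F n. G t x) * indicator {0..<real n} t" for n t
  have meas: "(\<lambda>t. ennreal (energy \<sigma> \<phi> \<psi> r t x)) \<in> borel_measurable borel" if "r < R" "x \<in> V" for r x
    using borel_measurable_energy[OF \<phi> \<psi> that(2,1)] by simp
  have meas_G: "(\<lambda>t. G t x) \<in> borel_measurable borel" if "x \<in> V" for x
    unfolding G_def using meas that by auto
  have meas_\<Phi>: "\<Phi> n \<in> borel_measurable lborel" for n
    unfolding \<Phi>_def using meas_G by (auto simp: F_def)
  have "incseq \<Phi>"
  proof (intro incseq_SucI le_funI)
    fix n t
    have "(\<Sum>x\<in>F n. G t x) \<le> (\<Sum>x\<in>F (Suc n). G t x)"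
      by (intro sum_mono2 fin) (auto simp: F_def)
    then show "\<Phi> n t \<le> \<Phi> (Suc n) t"
      unfolding \<Phi>_def by (intro mult_mono) (auto simp: indicator_def)
  qed
  have sup: "(\<integral>\<^sup>+x. G t x \<partial>count_space V) * indicator {0..} t \<le> (SUP n. \<Phi> n t)" for t
  proof (cases "0 \<le> t")
    case True
    have "(\<integral>\<^sup>+x. G t x \<partial>count_space V) \<le> (\<integral>\<^sup>+x. (SUP n. G t x * indicator (F n) x) \<partial>count_space V)"
    proof (intro nn_integral_mono)
      fix x assume "x \<in> space (count_space V)"
      then have "x \<in> F (Suc (to_nat_on V x))" by (simp add: F_def)
      then show "G t x \<le> (SUP n. G t x * indicator (F n) x)"
        by (intro SUP_upper2[of "Suc (to_nat_on V x)"]) auto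
    qed
    also have "\<dots> = (SUP n. \<integral>\<^sup>+x. G t x * indicator (F n) x \<partial>count_space V)"
      by (intro nn_integral_monotone_convergence_SUP)
         (auto simp: incseq_def le_fun_def F_def indicator_def)
    also have "\<dots> \<le> (SUP n. \<Phi> n t)"
    proof (rule SUP_least)
      fix n
      obtain k :: nat where k: "t < real k" using reals_Archimedean2 by blast
      \<comment> \<open>One index large enough both to contain \<open>F n\<close> and to have
        \<open>t\<close> inside the time window.\<close>
      define l where "l = max n k"
      have "(\<integral>\<^sup>+x. G t x * indicator (F n) x \<partial>count_space V) = (\<Sum>x\<in>F n. G t x)"
      proof -
        have "(\<integral>\<^sup>+x. G t x * indicator (F n) x \<partial>count_space V) = (\<integral>\<^sup>+x. G t x \<partial>count_space (F n))"
          by (subst nn_integral_restrict_space[symmetric])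
             (auto simp: restrict_count_space F_def Int_absorb1 intro!: arg_cong[where f = "\<lambda>M. nn_integral M _"]
               arg_cong[where f = count_space])
        then show ?thesis using fin by (simp add: nn_integral_count_space_finite)
      qed
      also have "\<dots> \<le> (\<Sum>x\<in>F l. G t x)"
        by (intro sum_mono2 fin) (auto simp: F_def l_def)
      also have "\<dots> = \<Phi> l t" using k True by (simp add: \<Phi>_def l_def)
      also have "\<dots> \<le> (SUP n. \<Phi> n t)" by (rule SUP_upper) simp
      finally show "(\<integral>\<^sup>+x. G t x * indicator (F n) x \<partial>count_space V) \<le> (SUP n. \<Phi> n t)" .
    qed
    finally show ?thesis using True by simp
  qed simp
  have "(\<Sum>r<R. \<integral>\<^sup>+t\<in>{0..}. (\<integral>\<^sup>+x. ennreal (energy \<sigma> \<phi> \<psi> r t x) \<partial>count_space V) \<partial>lborel)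
      = (\<integral>\<^sup>+t. (\<Sum>r<R. (\<integral>\<^sup>+x. ennreal (energy \<sigma> \<phi> \<psi> r t x) \<partial>count_space V) * indicator {0..} t) \<partial>lborel)"
  proof (rule nn_integral_sum[symmetric])
    fix r assume r: "r \<in> {..<R}"
    interpret sigma_finite_measure "count_space V"
      by (rule sigma_finite_measure_count_space_countable[OF V(2)])
    \<comment> \<open>Countability of \<open>V\<close> upgrades measurability in \<open>t\<close>
      for each \<open>x\<close> to joint measurability.\<close>
    have "(\<lambda>z. ennreal (energy \<sigma> \<phi> \<psi> r (snd z) (fst z))) \<in> borel_measurable (count_space V \<Otimes>\<^sub>M lborel)"
      using meas r by (intro measurable_pair_measure_countable1 V) auto
    then have "(\<lambda>(t, x). ennreal (energy \<sigma> \<phi> \<psi> r t x)) \<in> borel_measurable (lborel \<Otimes>\<^sub>M count_space V)"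
      by (subst (asm) measurable_pair_swap_iff) (simp add: case_prod_beta)
    then have "(\<lambda>t. \<integral>\<^sup>+x. ennreal (energy \<sigma> \<phi> \<psi> r t x) \<partial>count_space V) \<in> borel_measurable lborel"
      by (rule borel_measurable_nn_integral)
    then show "(\<lambda>t. (\<integral>\<^sup>+x. ennreal (energy \<sigma> \<phi> \<psi> r t x) \<partial>count_space V) * indicator {0..} t) \<in> borel_measurable lborel"
      by simp
  qed
  also have "\<dots> = (\<integral>\<^sup>+t. (\<integral>\<^sup>+x. G t x \<partial>count_space V) * indicator {0..} t \<partial>lborel)"
    unfolding G_def by (subst nn_integral_sum) (simp_all only: sum_distrib_right, simp)
  also have "\<dots> \<le> (\<integral>\<^sup>+t. (SUP n. \<Phi> n t) \<partial>lborel)"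
    by (intro nn_integral_mono sup)
  also have "\<dots> = (SUP n. \<integral>\<^sup>+t. \<Phi> n t \<partial>lborel)"
    by (rule nn_integral_monotone_convergence_SUP[OF \<open>incseq \<Phi>\<close> meas_\<Phi>])
  also have "\<dots> \<le> ennreal (C * (U powr (1 / p) * W powr (1 / q)))"
  proof (rule SUP_least)
    fix n
    have "(\<integral>\<^sup>+t. \<Phi> n t \<partial>lborel)
        = (\<integral>\<^sup>+t\<in>{0..<real n}. ennreal (\<Sum>r<R. \<Sum>x\<in>F n. energy \<sigma> \<phi> \<psi> r t x) \<partial>lborel)"
      unfolding \<Phi>_def G_def by (subst sum.swap) (simp add: sum_nonneg)
    also have "\<dots> \<le> ennreal (C * (U powr (1 / p) * W powr (1 / q)))"
    proof (cases "n = 0")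
      case False
      then show ?thesis
        by (intro energy_bound_finite[OF choi C p q V(1) U W fin _ \<sigma> \<phi> \<psi>]) (auto simp: F_def)
    qed simp
    finally show "(\<integral>\<^sup>+t. \<Phi> n t \<partial>lborel) \<le> ennreal (C * (U powr (1 / p) * W powr (1 / q)))" .
  qed
  finally show ?thesis .
qed

end

section \<open>Powers of cyclic groups\<close>

lemma (in group) mult_inv_cancel_right:
  assumes "x \<in> carrier G" "a \<in> carrier G"
  shows "x \<otimes> a \<otimes> inv a = x" "x \<otimes> inv a \<otimes> a = x"
  using assms by (simp_all add: m_assoc)

lemma (in group) bij_betw_mult_right:
  assumes "a \<in> carrier G"
  shows "bij_betw (\<lambda>x. x \<otimes> a) (carrier G) (carrier G)"
  by (rule bij_betw_byWitness[where f' = "\<lambda>x. x \<otimes> inv a"]) (use assms in \<open>auto simp: m_assoc\<close>)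

text \<open>The facts through which both kinds of cyclic group enter; 0 and 1 are the coordinates of
  \<open>unit_elem\<close>.\<close>

locale cyclic_power =
  fixes G :: "int monoid" and N :: nat
  assumes group_G: "group G" and gens: "0 \<in> carrier G" "1 \<in> carrier G" and N: "1 \<le> N"
begin

abbreviation P :: "(nat \<Rightarrow> int) monoid" where
  "P \<equiv> power_group G N"

lemma group_P: "group P"
  by (simp add: group_G)

text \<open>All \<open>2 * N\<close> directions in one list for \<open>jump_flow\<close>;
  \<open>r\<close> and \<open>N + r\<close> are inverse translations when
  \<open>r < N\<close>.\<close>

definition shift :: "nat \<Rightarrow> (nat \<Rightarrow> int) \<Rightarrow> nat \<Rightarrow> int" where
  "shift r n = (if r < N then n \<otimes>\<^bsub>P\<^esub> unit_elem N (Suc r) else n \<otimes>\<^bsub>P\<^esub> inv\<^bsub>P\<^esub> unit_elem N (Suc (r - N)))"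

lemma unit_elem_in: "unit_elem N i \<in> carrier P"
  using gens by (auto simp: unit_elem_def)

sublocale jump_flow "carrier P" shift "2 * N"
proof
  interpret P: group P by (rule group_P)
  show "bij_betw (shift r) (carrier P) (carrier P)" for r
  proof (cases "r < N")
    case True
    then have "shift r = (\<lambda>n. n \<otimes>\<^bsub>P\<^esub> unit_elem N (Suc r))" by (intro ext) (simp add: shift_def)
    then show ?thesis using P.bij_betw_mult_right[OF unit_elem_in] by simp
  next
    case False
    then have "shift r = (\<lambda>n. n \<otimes>\<^bsub>P\<^esub> inv\<^bsub>P\<^esub> unit_elem N (Suc (r - N)))" by (intro ext) (simp add: shift_def)
    then show ?thesis using P.bij_betw_mult_right[OF P.inv_closed[OF unit_elem_in]] by simp
  qed
qed (use N in simp)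

lemma sum_double: "(\<Sum>r<2 * N. a r) = (\<Sum>r<N. a r) + (\<Sum>r<N. a (N + r))"
  for a :: "nat \<Rightarrow> 'b :: comm_monoid_add"
  using sum.nat_group[of a N 2] sum.shift_bounds_nat_ivl[of a 0 N N]
  by (simp add: numeral_2_eq_2 lessThan_atLeast0 add.commute mult_2)

text \<open>The second difference \<open>f(n + e) - 2 f(n) + f(n - e)\<close> is the sum of a
  forward and a backward gradient.\<close>

lemma laplacian_eq_gen:
  assumes n: "n \<in> carrier P"
  shows "laplacian G N \<phi> n = gen \<phi> n"
proof -
  interpret P: group P by (rule group_P)
  have "laplacian G N \<phi> n = (\<Sum>r<N. diff_plus G N (Suc r) (diff_minus G N (Suc r) \<phi>) n)"
    by (simp add: laplacian_def sum.atLeast1_atMost_eq)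
  also have "\<dots> = (\<Sum>r<N. grad r \<phi> n + grad (N + r) \<phi> n)"
  proof (intro sum.cong refl)
    fix r assume "r \<in> {..<N}"
    moreover have "n \<otimes>\<^bsub>P\<^esub> unit_elem N (Suc r) \<otimes>\<^bsub>P\<^esub> inv\<^bsub>P\<^esub> unit_elem N (Suc r) = n"
      using n unit_elem_in by (rule P.mult_inv_cancel_right)
    ultimately show "diff_plus G N (Suc r) (diff_minus G N (Suc r) \<phi>) n = grad r \<phi> n + grad (N + r) \<phi> n"
      by (simp add: diff_plus_def diff_minus_def grad_def shift_def
          del: inv_product_group mult_product_group carrier_product_group)
  qed
  also have "\<dots> = gen \<phi> n"
    by (simp add: gen_def sum_double sum.distrib)
  finally show ?thesis .
qed

lemma laplacian_power_eq_gen_power: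
  assumes "n \<in> carrier P"
  shows "(laplacian G N ^^ k) \<phi> n = (gen ^^ k) \<phi> n"
  using assms
proof (induction k arbitrary: n)
  case (Suc k)
  then have "gen ((laplacian G N ^^ k) \<phi>) n = gen ((gen ^^ k) \<phi>) n"
    unfolding gen_def grad_def using S_in by (intro sum.cong refl) auto
  then show ?case
    using laplacian_eq_gen[OF Suc.prems] by simp
qed simp

lemma heat_ext_eq_heat: "n \<in> carrier P \<Longrightarrow> heat_ext G N \<phi> n t = heat \<phi> t n"
  unfolding heat_ext_def heat_def by (simp only: laplacian_power_eq_gen_power)

lemma diff_plus_heat_ext:
  assumes "n \<in> carrier P" "r < N"
  shows "diff_plus G N (Suc r) (\<lambda>n. heat_ext G N \<phi> n t) n = grad r (heat \<phi> t) n"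
proof -
  have "n \<otimes>\<^bsub>P\<^esub> unit_elem N (Suc r) \<in> carrier P"
    using group.is_monoid[OF group_P] assms(1) unit_elem_in by (rule monoid.m_closed)
  then show ?thesis
    using assms by (simp only: diff_plus_def grad_def heat_ext_eq_heat shift_def if_True)
qed

text \<open>A backward gradient is minus the forward gradient at the other endpoint of the edge; in
  the product of two gradients the signs cancel.\<close>

lemma energy_backward:
  assumes "n \<in> carrier P" "r < N"
  shows "energy \<sigma> \<phi> \<psi> (N + r) t n = energy \<sigma> \<phi> \<psi> r t (shift (N + r) n)"
proof -
  interpret P: group P by (rule group_P)
  have "shift r (shift (N + r) n) = n"
    using assms P.mult_inv_cancel_right(2)[OF assms(1) unit_elem_in]
    by (simp add: shift_def del: inv_product_group mult_product_group carrier_product_group)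
  then have "grad (N + r) \<eta> n = - grad r \<eta> (shift (N + r) n)" for \<eta>
    by (simp add: grad_def)
  then show ?thesis by (simp add: energy_def)
qed

lemma nn_integral_energy_backward:
  assumes "r < N"
  shows "(\<integral>\<^sup>+n. ennreal (energy \<sigma> \<phi> \<psi> (N + r) t n) \<partial>count_space (carrier P))
    = (\<integral>\<^sup>+n. ennreal (energy \<sigma> \<phi> \<psi> r t n) \<partial>count_space (carrier P))"
proof -
  have "(\<integral>\<^sup>+n. ennreal (energy \<sigma> \<phi> \<psi> (N + r) t n) \<partial>count_space (carrier P))
      = (\<integral>\<^sup>+n. ennreal (energy \<sigma> \<phi> \<psi> r t (shift (N + r) n)) \<partial>count_space (carrier P))"
    using assms by (intro nn_integral_cong) (simp only: space_count_space energy_backward)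
  also have "\<dots> = (\<integral>\<^sup>+n. ennreal (energy \<sigma> \<phi> \<psi> r t n) \<partial>count_space (carrier P))"
    using assms by (intro nn_integral_bij_count_space bij) simp
  finally show ?thesis .
qed

text \<open>Finite support turns the integral into a finite sum, which dominates all partial sums;
  this supplies \<open>U\<close> and \<open>W\<close>.\<close>

lemma sum_powr_le_Lp_norm:
  assumes f: "test_function G N f" and r: "0 < r" and B: "finite B" "B \<subseteq> carrier P"
  shows "(\<Sum>n\<in>B. \<bar>f n\<bar> powr r) \<le> Lp_norm (count_space (carrier P)) r f powr r"
proof -
  have fin: "finite {n \<in> carrier P. f n \<noteq> 0}"
    using f by (simp only: test_function_def)
  have "(\<Sum>n\<in>B. \<bar>f n\<bar> powr r) = (\<Sum>n\<in>{n \<in> B. f n \<noteq> 0}. \<bar>f n\<bar> powr r)"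
    using B(1) by (intro sum.mono_neutral_right) auto
  also have "\<dots> \<le> (\<Sum>n\<in>{n \<in> carrier P. f n \<noteq> 0}. \<bar>f n\<bar> powr r)"
    using B fin by (intro sum_mono2) auto
  also have "\<dots> = (\<integral>n. \<bar>f n\<bar> powr r \<partial>count_space (carrier P))"
    using lebesgue_integral_count_space_finite_support[of "carrier P" "\<lambda>n. \<bar>f n\<bar> powr r"] fin
    by (simp del: carrier_product_group)
  also have "\<dots> = Lp_norm (count_space (carrier P)) r f powr r"
    using r by (simp add: Lp_norm_def powr_powr)
  finally show ?thesis .
qed

lemma heat_energy_bound:
  fixes p q C \<sigma> :: real
  assumes choi: "choi_bound TYPE(nat \<Rightarrow> real) p C"
    and p: "1 < p" and q: "q = p / (p - 1)" and \<sigma>: "\<sigma> = 1 \<or> \<sigma> = -1"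
    and f: "test_function G N f" and g: "test_function G N g"
  shows "(\<Sum>r<2 * N. \<integral>\<^sup>+t\<in>{0..}. (\<integral>\<^sup>+n. ennreal (energy \<sigma> f g r t n) \<partial>count_space (carrier P)) \<partial>lborel)
    \<le> ennreal C * (ennreal (Lp_norm (count_space (carrier P)) p f) * ennreal (Lp_norm (count_space (carrier P)) q g))"
proof -
  have q1: "1 < q" using p by (simp add: q field_simps)
  have nonneg: "0 \<le> Lp_norm M r h" for M r and h :: "'z \<Rightarrow> real" by (simp add: Lp_norm_def)
  \<comment> \<open>The walk estimate asks for a nonnegative constant. Enlarging \<open>C\<close>
    keeps it admissible, and \<open>ennreal\<close> does not see the difference.\<close>
  have "choi_bound TYPE(nat \<Rightarrow> real) p (max C 0)"
    using choi unfolding choi_bound_def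
    by (meson max.cobounded1 mult_right_mono nonneg order.trans)
  then have choi': "choi_bound TYPE((real \<times> (nat \<Rightarrow> int)) \<times> (nat \<Rightarrow> bool)) p (max C 0)"
    by (rule choi_bound_transfer[OF p])
  interpret P: group P by (rule group_P)
  have "countable (carrier P)"
    unfolding carrier_product_group by (rule countable_PiE) auto
  from energy_bound[OF choi' _ p q P.carrier_not_empty this
      sum_powr_le_Lp_norm[OF f] sum_powr_le_Lp_norm[OF g] \<sigma>] p q1
  have "(\<Sum>r<2 * N. \<integral>\<^sup>+t\<in>{0..}. (\<integral>\<^sup>+n. ennreal (energy \<sigma> f g r t n) \<partial>count_space (carrier P)) \<partial>lborel)
    \<le> ennreal (max C 0 * (Lp_norm (count_space (carrier P)) p f * Lp_norm (count_space (carrier P)) q g))"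
    by (simp add: powr_powr nonneg del: carrier_product_group)
  also have "\<dots> = ennreal (max C 0) * (ennreal (Lp_norm (count_space (carrier P)) p f)
      * ennreal (Lp_norm (count_space (carrier P)) q g))"
    by (simp add: ennreal_mult nonneg del: carrier_product_group)
  also have "ennreal (max C 0) = ennreal C" by (simp add: ennreal_max_0)
  finally show ?thesis .
qed

text \<open>If the Choi constant were infinite, its product with a zero norm would still be 0 in
  \<open>ennreal\<close>; so the left side must vanish by itself. A zero norm forces zero data on
  the carrier and hence a zero heat flow.\<close>

lemma energy_eq_0:
  assumes f: "test_function G N f" and r: "0 < s" "r < 2 * N" and n: "n \<in> carrier P" "0 \<le> t"
    and 0: "Lp_norm (count_space (carrier P)) s f = 0"
  shows "energy \<sigma> f g r t n = 0" "energy \<sigma> g f r t n = 0"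
proof -
  have "\<bar>f m\<bar> powr s \<le> 0" if "m \<in> carrier P" for m
    using sum_powr_le_Lp_norm[OF f r(1), of "{m}"] that 0 r(1) by (simp del: carrier_product_group)
  then have "bounded_by 0 f"
    using r(1) unfolding bounded_by_def by (simp del: carrier_product_group)
  then have "heat f t m = 0" if "m \<in> carrier P" for m
    using abs_heat_le[of 0 f m t] that n(2) by (simp del: carrier_product_group)
  then have "grad r (heat f t) n = 0"
    using n(1) S_in[OF r(2) n(1)] by (simp add: grad_def del: carrier_product_group)
  then show "energy \<sigma> f g r t n = 0" "energy \<sigma> g f r t n = 0"
    by (simp_all add: energy_def)
qed

end

theorem theorem4:
  fixes G :: "int monoid" and N :: nat and p q :: real
    and f g :: "(nat \<Rightarrow> int) \<Rightarrow> real" and part :: "real \<Rightarrow> real"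
  assumes G: "G = integer_group \<or> (\<exists>m\<ge>2. G = integer_mod_group m)"
    and N: "N \<ge> 1"
    and p: "1 < p" and q: "q = p / (p - 1)"
    and f: "test_function G N f" and g: "test_function G N g"
    and part: "part = (\<lambda>x. max x 0) \<or> part = (\<lambda>x. max (- x) 0)"
  shows "2 * (\<Sum>i=1..N. \<integral>\<^sup>+t\<in>{0..}. (\<integral>\<^sup>+n. ennreal (part
            (diff_plus G N i (\<lambda>n. heat_ext G N f n t) n *
             diff_plus G N i (\<lambda>n. heat_ext G N g n t) n))
            \<partial>count_space (carrier (power_group G N))) \<partial>lborel)
         \<le> choi_constant p *
           ennreal (Lp_norm (count_space (carrier (power_group G N))) p f) *
           ennreal (Lp_norm (count_space (carrier (power_group G N))) q g)"
proof -
  interpret cyclic_power G N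
  proof (rule cyclic_power.intro)
    \<comment> \<open>\<open>m \<ge> 2\<close> puts 1 into the carrier \<open>{0..<m}\<close> of the
      finite cyclic group.\<close>
    show "group G" "0 \<in> carrier G" "1 \<in> carrier G"
      using G by auto
  qed (rule N)
  obtain \<sigma> :: real where \<sigma>: "\<sigma> = 1 \<or> \<sigma> = -1" and part_eq: "part = (\<lambda>x. max (\<sigma> * x) 0)"
    using part that[of 1] that[of "-1"] by fastforce
  have q1: "1 < q" using p by (simp add: q field_simps)
  define I where "I r = (\<integral>\<^sup>+t\<in>{0..}. (\<integral>\<^sup>+n. ennreal (energy \<sigma> f g r t n) \<partial>count_space (carrier P)) \<partial>lborel)" for r
  define a where "a = ennreal (Lp_norm (count_space (carrier P)) p f)"
  define b where "b = ennreal (Lp_norm (count_space (carrier P)) q g)"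
  define K where "K i = (\<integral>\<^sup>+t\<in>{0..}. (\<integral>\<^sup>+n. ennreal (part
            (diff_plus G N i (\<lambda>n. heat_ext G N f n t) n *
             diff_plus G N i (\<lambda>n. heat_ext G N g n t) n))
            \<partial>count_space (carrier P)) \<partial>lborel)" for i
  have "K (Suc r) = I r" if "r < N" for r
    unfolding I_def K_def part_eq energy_def using that
    by (intro nn_integral_cong arg_cong2[where f = "(*)"] refl) (simp only: space_count_space diff_plus_heat_ext)
  moreover have "I (N + r) = I r" if "r < N" for r
    unfolding I_def using that by (simp only: nn_integral_energy_backward)
  ultimately have lhs: "2 * (\<Sum>i=1..N. K i) = (\<Sum>r<2 * N. I r)"
    unfolding sum_double by (simp add: sum.atLeast1_atMost_eq mult_2)
  have "(\<Sum>r<2 * N. I r) \<le> choi_constant p * (a * b)"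
  proof (cases "a * b = 0")
    case True
    then have "Lp_norm (count_space (carrier P)) p f = 0 \<or> Lp_norm (count_space (carrier P)) q g = 0"
      by (simp add: a_def b_def Lp_norm_def del: carrier_product_group)
    then have "energy \<sigma> f g r t n = 0" if "r < 2 * N" "n \<in> carrier P" "0 \<le> t" for r t n
      using energy_eq_0(1)[OF f _ that, of p] energy_eq_0(2)[OF g _ that, of q] p q1 by auto
    then have zero: "(\<integral>\<^sup>+n. ennreal (energy \<sigma> f g r t n) \<partial>count_space (carrier P)) * indicator {0..} t = 0"
      if "r < 2 * N" for r t
      using that by (auto simp: indicator_def nn_integral_0_iff_AE AE_count_space simp del: carrier_product_group)
    have "I r = 0" if "r < 2 * N" for r
      unfolding I_def by (simp only: zero[OF that] nn_integral_const mult_zero_left)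
    then show ?thesis by simp
  next
    case False
    have fin: "a * b \<noteq> \<top>" by (simp add: a_def b_def ennreal_mult_eq_top_iff)
    \<comment> \<open>Dividing by \<open>a * b\<close>, which is neither 0 nor infinite here,
      isolates the constant, so that the bounds for the individual \<open>C\<close> pass to the
      infimum even over an empty set.\<close>
    have "(\<Sum>r<2 * N. I r) / (a * b) \<le> choi_constant p"
      unfolding choi_constant_def
    proof (rule INF_greatest)
      fix C assume "C \<in> {C. choi_bound TYPE(nat \<Rightarrow> real) p C}"
      then have "(\<Sum>r<2 * N. I r) \<le> ennreal C * (a * b)"
        using heat_energy_bound[OF _ p q \<sigma> f g] by (simp add: I_def a_def b_def del: carrier_product_group)
      then show "(\<Sum>r<2 * N. I r) / (a * b) \<le> ennreal C"
        using False by (intro divide_le_posI_ennreal) (auto simp: zero_less_iff_neq_zero mult.commute)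
    qed
    then have "(\<Sum>r<2 * N. I r) / (a * b) * (a * b) \<le> choi_constant p * (a * b)"
      by (rule mult_right_mono) simp
    moreover have "(\<Sum>r<2 * N. I r) / (a * b) * (a * b) = (\<Sum>r<2 * N. I r)"
      using False fin by (metis ennreal_mult_divide_eq ennreal_times_divide mult.commute)
    ultimately show ?thesis by simp
  qed
  then show ?thesis
    unfolding lhs[symmetric] K_def by (simp only: a_def b_def mult.assoc)
qed

end
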